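(* Let $G$ be a simple connected planar graph in which every vertex has finite degree, with minimum degree $\delta(G)\geq 3$, and suppose $\kappa_{\mathrm{LLY}}(x,y)>0$ for every edge $xy\in E(G)$. Then the maximum degree satisfies $\Delta(G)\leq 17$.
   Context: For a vertex $x$ let $\Gamma(x)$ be its neighborhood and $d(x)=|\Gamma(x)|$; $d(\cdot,\cdot)$ denotes graph distance. For $0\le\alpha<1$ the $\alpha$-lazy random walk is $m_x^{\alpha}(x)=\alpha$, $m_x^{\alpha}(v)=(1-\alpha)/d(x)$ for $v\in\Gamma(x)$, and $0$ otherwise. For probability measures $m_1,m_2$ with finite support, $W(m_1,m_2)=\inf_A\sum_{u,v}A(u,v)d(u,v)$, the infimum over couplings $A$ of $m_1,m_2$ (equivalently $\sup_f\sum_u f(u)(m_1(u)-m_2(u))$ over $1$-Lipschitz $f$). Set $\kappa_\alpha(x,y)=1-W(m_x^\alpha,m_y^\alpha)/d(x,y)$ and the Lin–Lu–Yau Ricci curvature $\kappa_{\mathrm{LLY}}(x,y)=\lim_{\alpha\to1}\kappa_\alpha(x,y)/(1-\alpha)$. A graph is called positively curved if $\kappa_{\mathrm{LLY}}(x,y)>0$ for every edge $xy$. *)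

theory Defs
  imports "HOL-Probability.Probability" "HOL-Library.Extended_Nat"
begin

text \<open>A graph is given by a (possibly infinite) vertex set \<open>V\<close> and a set \<open>E\<close> of
  two-element subsets of \<open>V\<close>.\<close>

definition simple_graph :: "'a set \<Rightarrow> 'a set set \<Rightarrow> bool" where
  "simple_graph V E \<longleftrightarrow> (\<forall>e\<in>E. e \<subseteq> V \<and> card e = 2)"

definition adj :: "'a set set \<Rightarrow> 'a rel" where
  "adj E = {(u, v). {u, v} \<in> E}"

definition nbhd :: "'a set set \<Rightarrow> 'a \<Rightarrow> 'a set" where
  "nbhd E x = {v. {x, v} \<in> E}"

definition locally_finite_graph :: "'a set \<Rightarrow> 'a set set \<Rightarrow> bool" where
  "locally_finite_graph V E \<longleftrightarrow> (\<forall>x\<in>V. finite (nbhd E x))"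

text \<open>The following degree notions are meaningful for locally finite graphs only
  (\<open>card\<close> of an infinite set is \<open>0\<close>). The maximum degree lives in \<open>enat\<close> because the
  degrees of an infinite graph may be unbounded.\<close>

definition degree :: "'a set set \<Rightarrow> 'a \<Rightarrow> nat" where
  "degree E x = card (nbhd E x)"

definition min_degree :: "'a set \<Rightarrow> 'a set set \<Rightarrow> enat" where
  "min_degree V E = (INF x\<in>V. enat (degree E x))"

definition max_degree :: "'a set \<Rightarrow> 'a set set \<Rightarrow> enat" where
  "max_degree V E = (SUP x\<in>V. enat (degree E x))"

definition connected_graph :: "'a set \<Rightarrow> 'a set set \<Rightarrow> bool" where
  "connected_graph V E \<longleftrightarrow> (\<forall>u\<in>V. \<forall>v\<in>V. (u, v) \<in> (adj E)\<^sup>*)"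

text \<open>Length of a shortest walk; only meaningful if \<open>u\<close> and \<open>v\<close> are joined by a walk.\<close>

definition gdist :: "'a set set \<Rightarrow> 'a \<Rightarrow> 'a \<Rightarrow> nat" where
  "gdist E u v = (LEAST n. (u, v) \<in> adj E ^^ n)"

text \<open>A drawing in the plane places the vertices at distinct points \<open>p v\<close> and draws every
  edge \<open>e\<close> as an arc (injective continuous path) \<open>\<gamma> e\<close> between its two ends, such that an
  arc contains no vertices besides its ends and two different arcs meet only in common
  ends.\<close>

definition plane_drawing ::
  "'a set \<Rightarrow> 'a set set \<Rightarrow> ('a \<Rightarrow> complex) \<Rightarrow> ('a set \<Rightarrow> real \<Rightarrow> complex) \<Rightarrow> bool" where
  "plane_drawing V E p \<gamma> \<longleftrightarrow>
     inj_on p V \<and>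
     (\<forall>e\<in>E. arc (\<gamma> e) \<and> {pathstart (\<gamma> e), pathfinish (\<gamma> e)} = p ` e \<and>
             path_image (\<gamma> e) \<inter> p ` V = p ` e) \<and>
     (\<forall>e\<in>E. \<forall>e'\<in>E. e \<noteq> e' \<longrightarrow> path_image (\<gamma> e) \<inter> path_image (\<gamma> e') = p ` (e \<inter> e'))"

definition planar_graph :: "'a set \<Rightarrow> 'a set set \<Rightarrow> bool" where
  "planar_graph V E \<longleftrightarrow> (\<exists>p \<gamma>. plane_drawing V E p \<gamma>)"

text \<open>The \<open>\<alpha>\<close>-lazy random walk: stay at \<open>x\<close> with probability \<open>\<alpha>\<close>, otherwise move to a
  uniformly chosen neighbour. The lemma \<open>pmf_lazy_walk\<close> below gives the point masses.\<close>

definition lazy_walk :: "'a set set \<Rightarrow> real \<Rightarrow> 'a \<Rightarrow> 'a pmf" where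
  "lazy_walk E \<alpha> x =
     bind_pmf (bernoulli_pmf \<alpha>) (\<lambda>stay. if stay then return_pmf x else pmf_of_set (nbhd E x))"

lemma pmf_lazy_walk:
  assumes "simple_graph V E" "finite (nbhd E x)" "nbhd E x \<noteq> {}" "0 \<le> \<alpha>" "\<alpha> < 1"
  shows "pmf (lazy_walk E \<alpha> x) v =
    (if v = x then \<alpha> else if v \<in> nbhd E x then (1 - \<alpha>) / real (degree E x) else 0)"
proof -
  have "x \<notin> nbhd E x"
    using assms(1) by (auto simp: simple_graph_def nbhd_def)
  then show ?thesis
    using assms by (auto simp: lazy_walk_def pmf_bind degree_def indicator_def)
qed

definition couplings :: "'a pmf \<Rightarrow> 'a pmf \<Rightarrow> ('a \<times> 'a) pmf set" where
  "couplings m1 m2 = {A. map_pmf fst A = m1 \<and> map_pmf snd A = m2}"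

definition wasserstein :: "'a set set \<Rightarrow> 'a pmf \<Rightarrow> 'a pmf \<Rightarrow> real" where
  "wasserstein E m1 m2 =
     (INF A\<in>couplings m1 m2. measure_pmf.expectation A (\<lambda>(u, v). real (gdist E u v)))"

definition kappa :: "'a set set \<Rightarrow> real \<Rightarrow> 'a \<Rightarrow> 'a \<Rightarrow> real" where
  "kappa E \<alpha> x y =
     1 - wasserstein E (lazy_walk E \<alpha> x) (lazy_walk E \<alpha> y) / real (gdist E x y)"

definition kappa_LLY :: "'a set set \<Rightarrow> 'a \<Rightarrow> 'a \<Rightarrow> real" where
  "kappa_LLY E x y = Lim (at_left 1) (\<lambda>\<alpha>. kappa E \<alpha> x y / (1 - \<alpha>))"

definition positively_curved :: "'a set set \<Rightarrow> bool" where
  "positively_curved E \<longleftrightarrow> (\<forall>x y. {x, y} \<in> E \<longrightarrow> kappa_LLY E x y > 0)"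

end

(*
Let x have degree D >= 18.  Replacing each arc at x by its part after the last exit from a small
disc and mapping the exterior of the disc to a half plane, Fashoda's theorem yields a linear order
u_0, ..., u_{D-1} of the neighbours of x in which disjoint connections between neighbours never
interleave.  Testing the curvature of an edge x u_k with the 1-Lipschitz function that is 1 on u_k
and on a set S of neighbours of u_k, -1 on the neighbours of x at distance at least 2 from these, and
0 elsewhere, forces every set S of neighbours of a vertex u_k of small degree to reach many
neighbours of x.

Call (i, j) separating if nothing strictly between u_i and u_j is joined to the outside of [i, j],
directly or through a common neighbour other than x.  A separating pair (k, k + 2) makes u_{k+1} an
"ear": its only neighbours are x, u_k and u_{k+2}, and u_k and u_{k+2} have at least 7 further
neighbours among the u's.  A separating pair of length at least 3 which is minimal up to ears has
length exactly 4, with each of its ends having at least 5 neighbours among the u's elsewhere.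
Finally, inside a minimal separating pair of length at least 5 these ends would have at most 3 such
neighbours, so that no such pair exists, although (0, D - 1) is one.
*)
theory Submission
  imports Defs
begin

section \<open>The order of the arcs at a vertex of a plane drawing\<close>

text \<open>Both images are bounded, so they fit into a box whose bottom edge lies on the real axis.
  All four ends lie on that edge, and Fashoda's theorem applies in \<open>real^2\<close>.\<close>

lemma half_plane_interlace:
  fixes f g :: "real \<Rightarrow> complex"
  assumes f: "path f" and g: "path g"
    and f_up: "\<And>z. z \<in> path_image f \<Longrightarrow> 0 \<le> Im z" and g_up: "\<And>z. z \<in> path_image g \<Longrightarrow> 0 \<le> Im z"
    and ends: "Im (pathstart f) = 0" "Im (pathfinish f) = 0" "Im (pathstart g) = 0" "Im (pathfinish g) = 0"
    and less: "Re (pathstart f) < Re (pathstart g)" "Re (pathstart g) < Re (pathfinish f)"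
      "Re (pathfinish f) < Re (pathfinish g)"
  shows "path_image f \<inter> path_image g \<noteq> {}"
proof -
  define T :: "complex \<Rightarrow> real^2" where "T = (\<lambda>z. vector [Re z, Im z])"
  have T_nth: "T z $ 1 = Re z" "T z $ 2 = Im z" for z
    by (simp_all add: T_def)
  have T_eq: "T = (\<lambda>z. \<chi> i. if i = 1 then Re z else Im z)"
    by (auto simp: vec_eq_iff forall_2 T_nth)
  have contT: "continuous_on A T" for A
    unfolding T_eq by (intro continuous_on_vec_lambda, rename_tac i, case_tac "i = 1") (auto intro!: continuous_intros)
  have inj: "T z = T w \<Longrightarrow> z = w" for z w
    using T_nth[of z] T_nth[of w] by (simp add: complex_eq_iff)
  have "bounded (path_image f \<union> path_image g)"
    using f g by (simp add: bounded_path_image)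
  then obtain M where M: "\<And>z. z \<in> path_image f \<union> path_image g \<Longrightarrow> norm z \<le> M"
    unfolding bounded_iff by blast
  define a b :: "real^2" where "a = vector [-M, 0]" and "b = vector [M, M]"
  have box: "T z \<in> cbox a b" if "z \<in> path_image f \<union> path_image g" for z
    using M[OF that] f_up g_up that abs_Re_le_cmod[of z] abs_Im_le_cmod[of z]
    by (auto simp: mem_box_cart forall_2 T_nth a_def b_def)
  have a2: "a $ 2 = 0" by (simp add: a_def)
  have "\<exists>z. z \<in> path_image (T \<circ> f) \<and> z \<in> path_image (T \<circ> g)"
  proof (rule fashoda_interlace[of "T \<circ> f" "T \<circ> g" a b])
    show "path (T \<circ> f)" "path (T \<circ> g)"
      using f g contT by (auto intro: path_continuous_image)
    show "path_image (T \<circ> f) \<subseteq> cbox a b" "path_image (T \<circ> g) \<subseteq> cbox a b"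
      using box by (auto simp: path_image_compose)
  qed (use ends less in \<open>auto simp: pathstart_compose pathfinish_compose T_nth a2\<close>)
  then show ?thesis
    using inj unfolding path_image_compose by blast
qed

text \<open>This Moebius map takes the exterior of the unit disc to the upper half plane and the
  unit circle without 1 to the real line. At 1 the division by zero gives the default 0, so paths
  have to avoid this point.\<close>

definition cayley :: "complex \<Rightarrow> complex" where
  "cayley w = \<i> * ((w + 1) / (w - 1))"

lemma Im_cayley: "Im (cayley w) = ((norm w)\<^sup>2 - 1) / (norm (w - 1))\<^sup>2"
proof -
  have "Im (cayley w) = Re ((w + 1) * cnj (w - 1) / of_real ((norm (w - 1))\<^sup>2))"
    by (simp add: cayley_def complex_div_cnj[of "w + 1" "w - 1"] flip: of_real_power)
  also have "\<dots> = Re ((w + 1) * cnj (w - 1)) / (norm (w - 1))\<^sup>2"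
    by (rule Re_divide_of_real)
  also have "Re ((w + 1) * cnj (w - 1)) = (norm w)\<^sup>2 - 1"
    unfolding cmod_power2 by (simp add: algebra_simps power2_eq_square)
  finally show ?thesis .
qed

lemma cayley_inject:
  assumes "w \<noteq> 1" "v \<noteq> 1" "cayley w = cayley v"
  shows "w = v"
proof -
  have "(w + 1) / (w - 1) = (v + 1) / (v - 1)"
    using assms(3) unfolding cayley_def by (metis complex_i_not_zero mult_cancel_left)
  then have "(w + 1) * (v - 1) = (v + 1) * (w - 1)"
    using assms(1,2) by (simp add: frac_eq_eq)
  then show ?thesis by (simp add: algebra_simps)
qed

text \<open>\<open>cayley\<close> carries the picture to the half plane, and its injectivity away
  from 1 pulls the meeting point back.\<close>

lemma exterior_interlace:
  fixes f g :: "real \<Rightarrow> complex"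
  assumes f: "path f" and g: "path g"
    and f_out: "\<And>z. z \<in> path_image f \<Longrightarrow> 1 \<le> norm z \<and> z \<noteq> 1"
    and g_out: "\<And>z. z \<in> path_image g \<Longrightarrow> 1 \<le> norm z \<and> z \<noteq> 1"
    and ends: "norm (pathstart f) = 1" "norm (pathfinish f) = 1" "norm (pathstart g) = 1" "norm (pathfinish g) = 1"
    and less: "Re (cayley (pathstart f)) < Re (cayley (pathstart g))"
      "Re (cayley (pathstart g)) < Re (cayley (pathfinish f))"
      "Re (cayley (pathfinish f)) < Re (cayley (pathfinish g))"
  shows "path_image f \<inter> path_image g \<noteq> {}"
proof -
  have cont: "continuous_on A cayley" if "1 \<notin> A" for A
    unfolding cayley_def using that by (intro continuous_intros) auto
  have "path_image (cayley \<circ> f) \<inter> path_image (cayley \<circ> g) \<noteq> {}"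
  proof (rule half_plane_interlace)
    show "path (cayley \<circ> f)" "path (cayley \<circ> g)"
      using f g f_out g_out by (auto intro!: path_continuous_image cont)
    show "0 \<le> Im z" if "z \<in> path_image (cayley \<circ> f)" for z
      using that f_out by (auto simp: path_image_compose Im_cayley)
    show "0 \<le> Im z" if "z \<in> path_image (cayley \<circ> g)" for z
      using that g_out by (auto simp: path_image_compose Im_cayley)
  qed (use ends less f_out g_out in \<open>auto simp: pathstart_compose pathfinish_compose Im_cayley
        pathstart_in_path_image pathfinish_in_path_image\<close>)
  then show ?thesis
    using cayley_inject f_out g_out unfolding path_image_compose by blast
qed

text \<open>Cutting at the last rather than the first exit keeps the rest of the arc away from the disc,
  so that arbitrarily wild arcs may be treated as radial near \<open>z\<close>.\<close>

lemma last_exit: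
  fixes g :: "real \<Rightarrow> complex"
  assumes g: "path g" and start: "pathstart g = z" and fin: "r < norm (pathfinish g - z)" and r: "0 < r"
  obtains h where "path h" "path_image h \<subseteq> path_image g" "pathfinish h = pathfinish g"
    "norm (pathstart h - z) = r"
    "\<And>w. w \<in> path_image h \<Longrightarrow> r \<le> norm (w - z)"
    "\<And>w. w \<in> path_image h \<Longrightarrow> norm (w - z) = r \<Longrightarrow> w = pathstart h"
proof -
  define S where "S = {t \<in> {0..1}. norm (g t - z) \<le> r}"
  have cont: "continuous_on {0..1} (\<lambda>t. norm (g t - z))"
    using g unfolding path_def by (intro continuous_intros)
  have "S = {0..1} \<inter> (\<lambda>t. norm (g t - z)) -` {..r}"
    by (auto simp: S_def)
  then have "closed S"
    using continuous_on_closed_vimage[of "{0..1::real}" "\<lambda>t. norm (g t - z)"] cont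
    by (auto simp: Int_commute)
  then have S: "compact S"
    by (metis (no_types, lifting) S_def compact_eq_bounded_closed bounded_closed_interval bounded_subset mem_Collect_eq subsetI)
  moreover have "0 \<in> S"
    using start r by (simp add: S_def pathstart_def)
  ultimately obtain \<tau> where \<tau>: "\<tau> \<in> S" "\<And>t. t \<in> S \<Longrightarrow> t \<le> \<tau>"
    using compact_attains_sup[of S] by blast
  have \<tau>01: "0 \<le> \<tau>" "\<tau> \<le> 1" "norm (g \<tau> - z) \<le> r"
    using \<tau> by (auto simp: S_def)
  have after: "r < norm (g t - z)" if "\<tau> < t" "t \<le> 1" for t
  proof (rule ccontr)
    assume "\<not> r < norm (g t - z)"
    then have "t \<in> S" using that \<tau>01 by (simp add: S_def)
    then show False using \<tau>(2) that by fastforce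
  qed
  have "norm (g \<tau> - z) = r"
  proof (rule ccontr)
    assume "norm (g \<tau> - z) \<noteq> r"
    then have less: "norm (g \<tau> - z) < r" using \<tau>01 by simp
    have "r < norm (g 1 - z)" using fin by (simp add: pathfinish_def)
    \<comment> \<open>The path ends outside the disc, so a distance below \<open>r\<close> at the
      last time \<tau> in \<open>S\<close> would climb back to \<open>r\<close> at a later time,
      which would also be in \<open>S\<close>.\<close>
    then obtain t where t: "\<tau> \<le> t" "t \<le> 1" "norm (g t - z) = r"
      using IVT'[of "\<lambda>t. norm (g t - z)" \<tau> r 1] less \<tau>01 continuous_on_subset[OF cont]
      by force
    then have "t \<in> S" using \<tau>01 by (simp add: S_def)
    then show False using \<tau>(2) t less by force
  qed
  then have eq: "norm (g \<tau> - z) = r" .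
  define h where "h = subpath \<tau> 1 g"
  have im: "path_image h = g ` {\<tau>..1}"
    using \<tau>01 by (simp add: h_def path_image_subpath)
  show thesis
  proof (rule that[of h])
    show "path h" using g \<tau>01 by (simp add: h_def)
    show "path_image h \<subseteq> path_image g" using im \<tau>01 by (auto simp: path_image_def)
    show "pathfinish h = pathfinish g" by (simp add: h_def pathfinish_def[of g])
    show "norm (pathstart h - z) = r" using eq by (simp add: h_def)
    show "r \<le> norm (w - z)" if "w \<in> path_image h" for w
      using that after eq unfolding im by (metis atLeastAtMost_iff image_iff less_eq_real_def)
    show "w = pathstart h" if "w \<in> path_image h" "norm (w - z) = r" for w
      using that after unfolding im by (force simp: h_def less_eq_real_def)
  qed
qed

text \<open>Only edges in \<open>F\<close> are used. A finite \<open>F\<close> is needed below because infinitely many arcs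
  of a plane drawing may accumulate at a vertex.\<close>

definition linked :: "'a set set \<Rightarrow> 'a set \<Rightarrow> 'a \<Rightarrow> 'a \<Rightarrow> bool" where
  "linked F A a b \<longleftrightarrow> a \<in> A \<and> (\<lambda>u v. u \<in> A \<and> v \<in> A \<and> {u, v} \<in> F)\<^sup>*\<^sup>* a b"

lemma linked_in: "linked F A a b \<Longrightarrow> a \<in> A \<and> b \<in> A"
  unfolding linked_def by (erule conjE, erule rtranclp.cases) auto

text \<open>The arcs along the walk are concatenated, each reversed if it is oriented against the
  walk. The inserted point \<open>p a\<close> covers the walk without edges.\<close>

lemma linked_path:
  assumes drawing: "plane_drawing V E p \<gamma>" and F: "F \<subseteq> E" and "linked F A a b"
  obtains g where "path g" "pathstart g = p a" "pathfinish g = p b"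
    "path_image g \<subseteq> insert (p a) (\<Union>e\<in>{e\<in>F. e \<subseteq> A}. path_image (\<gamma> e))"
proof -
  let ?I = "insert (p a) (\<Union>e\<in>{e\<in>F. e \<subseteq> A}. path_image (\<gamma> e))"
  have "a \<in> A" "(\<lambda>u v. u \<in> A \<and> v \<in> A \<and> {u, v} \<in> F)\<^sup>*\<^sup>* a b"
    using assms(3) by (auto simp: linked_def)
  from this(2) have "\<exists>g. path g \<and> pathstart g = p a \<and> pathfinish g = p b \<and> path_image g \<subseteq> ?I"
  proof (induction rule: rtranclp_induct)
    case base
    show ?case
      using \<open>a \<in> A\<close> by (intro exI[of _ "\<lambda>_. p a"]) (auto simp: path_def pathstart_def pathfinish_def path_image_def)
  next
    case (step u v)
    then obtain g where g: "path g" "pathstart g = p a" "pathfinish g = p u" "path_image g \<subseteq> ?I"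
      by blast
    have uv: "{u, v} \<in> F" "u \<in> A" "v \<in> A" using step by auto
    then have "{u, v} \<in> E" using F by blast
    then have arc: "arc (\<gamma> {u, v})" and "{pathstart (\<gamma> {u, v}), pathfinish (\<gamma> {u, v})} = p ` {u, v}"
      using drawing unfolding plane_drawing_def by blast+
    then have e: "{pathstart (\<gamma> {u, v}), pathfinish (\<gamma> {u, v})} = {p u, p v}" by simp
    from arc have pth: "path (\<gamma> {u, v})" by (rule arc_imp_path)
    have "\<exists>h. path h \<and> pathstart h = p u \<and> pathfinish h = p v \<and> path_image h = path_image (\<gamma> {u, v})"
    proof (cases "pathstart (\<gamma> {u, v}) = p u")
      case True
      then have "pathfinish (\<gamma> {u, v}) = p v" using e by (auto simp: doubleton_eq_iff)
      then show ?thesis using True pth by blast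
    next
      case False
      then have "pathstart (\<gamma> {u, v}) = p v" "pathfinish (\<gamma> {u, v}) = p u"
        using e by (auto simp: doubleton_eq_iff)
      then show ?thesis using pth
        by (intro exI[of _ "reversepath (\<gamma> {u, v})"]) auto
    qed
    then obtain h where h: "path h" "pathstart h = p u" "pathfinish h = p v"
      "path_image h = path_image (\<gamma> {u, v})" by blast
    have "path_image h \<subseteq> ?I" using h uv by auto
    then show ?case
      using g h by (intro exI[of _ "g +++ h"]) (auto simp: path_image_join)
  qed
  then show ?thesis using that by blast
qed

text \<open>Neighbours are ordered by the points where their arcs last leave a small circle around
  \<open>p x\<close>, cut open at one point. Interleaved connections, prolonged by the tails of
  these arcs, would meet outside the disc, whereas edges of the two sides can share only the vertex
  \<open>x\<close> at its centre.\<close>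

lemma planar_rotation:
  assumes graph: "simple_graph V E" and drawing: "plane_drawing V E p \<gamma>"
    and x: "x \<in> V" and fin_nbhd: "finite (nbhd E x)"
    and F: "finite F" "F \<subseteq> E" "\<And>e. e \<in> F \<Longrightarrow> x \<notin> e"
  obtains pos :: "'a \<Rightarrow> real" where "inj_on pos (nbhd E x)"
    and "\<And>A B a b c d. \<lbrakk>A \<inter> B = {}; x \<notin> A; x \<notin> B; linked F A a c; linked F B b d;
      {a, b, c, d} \<subseteq> nbhd E x; pos a < pos b; pos b < pos c; pos c < pos d\<rbrakk> \<Longrightarrow> False"
proof -
  define U where "U = nbhd E x"
  define z where "z = p x"
  have inj: "inj_on p V"
    and ends: "\<And>e. e \<in> E \<Longrightarrow> arc (\<gamma> e) \<and> {pathstart (\<gamma> e), pathfinish (\<gamma> e)} = p ` e"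
    and vert: "\<And>e. e \<in> E \<Longrightarrow> path_image (\<gamma> e) \<inter> p ` V = p ` e"
    and cross: "\<And>e e'. e \<in> E \<Longrightarrow> e' \<in> E \<Longrightarrow> e \<noteq> e' \<Longrightarrow>
                  path_image (\<gamma> e) \<inter> path_image (\<gamma> e') = p ` (e \<inter> e')"
    using drawing unfolding plane_drawing_def by blast+
  have edge: "\<And>e. e \<in> E \<Longrightarrow> e \<subseteq> V \<and> card e = 2"
    using graph by (simp add: simple_graph_def)
  have U: "{x, u} \<in> E" "u \<in> V" "u \<noteq> x" "p u \<noteq> z" if "u \<in> U" for u
  proof -
    show e: "{x, u} \<in> E" using that by (simp add: U_def nbhd_def)
    show "u \<in> V" using edge[OF e] by simp
    show "u \<noteq> x" using edge[OF e] by auto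
    then show "p u \<noteq> z" using inj x \<open>u \<in> V\<close> by (auto simp: z_def inj_on_def)
  qed
  \<comment> \<open>\<open>K\<close> is what the small disc must avoid. Finiteness of
    \<open>F\<close> makes it closed, hence at positive distance from \<open>z\<close>.\<close>
  define K where "K = p ` U \<union> (\<Union>e\<in>F. path_image (\<gamma> e))"
  have "closed K"
    unfolding K_def using F ends fin_nbhd
    by (intro closed_Un closed_UN finite_imp_closed finite_imageI)
       (auto simp: U_def intro!: closed_path_image arc_imp_path)
  moreover have "z \<notin> path_image (\<gamma> e)" if "e \<in> F" for e
  proof
    assume "z \<in> path_image (\<gamma> e)"
    then have "p x \<in> p ` e" using vert[of e] that F x by (auto simp: z_def)
    then show False
      using that F edge[of e] inj x by (metis imageE inj_onD subset_iff)
  qed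
  moreover have "z \<notin> p ` U" using U(4) by (metis imageE)
  ultimately have K: "closed K" "z \<notin> K" by (auto simp: K_def)
  obtain \<delta> where \<delta>: "\<delta> > 0" "\<And>w. w \<in> K \<Longrightarrow> \<delta> \<le> dist z w"
    using separate_point_closed[OF K] by metis
  define r where "r = \<delta> / 2"
  have far: "r < norm (w - z)" if "w \<in> K" for w
    using \<delta> \<delta>(2)[OF that] by (auto simp: r_def dist_norm norm_minus_commute)
  have r0: "0 < r" using \<delta> by (simp add: r_def)
  define tail where "tail u h \<longleftrightarrow> path h \<and> path_image h \<subseteq> path_image (\<gamma> {x, u}) \<and> pathfinish h = p u \<and>
      norm (pathstart h - z) = r \<and> (\<forall>w \<in> path_image h. r \<le> norm (w - z)) \<and>
      (\<forall>w \<in> path_image h. norm (w - z) = r \<longrightarrow> w = pathstart h)" for u h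
  have "\<exists>h. tail u h" if u: "u \<in> U" for u
  proof -
    let ?g = "\<gamma> {x, u}"
    have pg: "path ?g" and st: "{pathstart ?g, pathfinish ?g} = {z, p u}"
      using ends[OF U(1)[OF u]] by (auto simp: z_def arc_imp_path)
    have "\<exists>g. path g \<and> pathstart g = z \<and> pathfinish g = p u \<and> path_image g = path_image ?g"
    proof (cases "pathstart ?g = z")
      case True
      then show ?thesis using pg st by (metis doubleton_eq_iff)
    next
      case False
      then have "pathstart (reversepath ?g) = z" "pathfinish (reversepath ?g) = p u"
        using st by (auto simp: doubleton_eq_iff)
      then show ?thesis using pg by (metis path_image_reversepath path_reversepath)
    qed
    then obtain g where g: "path g" "pathstart g = z" "pathfinish g = p u" "path_image g = path_image ?g"
      by blast
    have "r < norm (pathfinish g - z)" using far u g(3) by (simp add: K_def)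
    from last_exit[OF g(1,2) this r0] obtain h where h: "path h" "path_image h \<subseteq> path_image g"
      "pathfinish h = pathfinish g" "norm (pathstart h - z) = r"
      "\<And>w. w \<in> path_image h \<Longrightarrow> r \<le> norm (w - z)"
      "\<And>w. w \<in> path_image h \<Longrightarrow> norm (w - z) = r \<Longrightarrow> w = pathstart h" by metis
    then have "tail u h" unfolding tail_def g(3,4) by blast
    then show ?thesis by blast
  qed
  then obtain h where h: "\<And>u. u \<in> U \<Longrightarrow> tail u (h u)" by metis
  define s where "s u = pathstart (h u)" for u
  have h: "path (h u)" "path_image (h u) \<subseteq> path_image (\<gamma> {x, u})" "pathfinish (h u) = p u"
      "pathstart (h u) = s u" "norm (s u - z) = r"
      "\<And>w. w \<in> path_image (h u) \<Longrightarrow> r \<le> norm (w - z)"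
      "\<And>w. w \<in> path_image (h u) \<Longrightarrow> norm (w - z) = r \<Longrightarrow> w = s u" if "u \<in> U" for u
    using h[OF that] unfolding tail_def s_def by blast+
  have s: "norm (s u - z) = r" "s u \<in> path_image (\<gamma> {x, u})" if "u \<in> U" for u
    using h(2,4,5)[OF that] pathstart_in_path_image[of "h u"] by auto
  \<comment> \<open>Only finitely many tails start on the circle, so some point \<zeta> of it is
    free. It becomes the cut of the cyclic order.\<close>
  have "infinite (sphere z r)"
  proof
    assume "finite (sphere z r)"
    moreover have "(\<lambda>t. z + of_real r * cis t) ` {0<..<pi} \<subseteq> sphere z r"
      using r0 by (auto simp: dist_norm norm_mult)
    moreover have "inj_on (\<lambda>t. z + of_real r * cis t) {0<..<pi}"
      using r0 by (auto intro!: inj_onI simp: complex_eq_iff cos_inj_pi)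
    ultimately have "finite {0<..<pi}"
      by (metis finite_imageD finite_subset)
    then show False using infinite_Ioo[OF pi_gt_zero] by blast
  qed
  then obtain \<zeta> where \<zeta>: "norm (\<zeta> - z) = r" "\<zeta> \<notin> s ` U"
    using fin_nbhd by (metis (no_types, lifting) U_def dist_norm finite_imageI finite_subset mem_sphere norm_minus_commute subsetI)
  \<comment> \<open>\<open>N\<close> normalises the circle to the unit circle and the cut \<zeta> to
    1, which \<open>cayley\<close> sends to infinity.\<close>
  define N where "N w = (w - z) / (\<zeta> - z)" for w
  have norm_N: "norm (N w) = norm (w - z) / r" for w
    using \<zeta> by (simp add: N_def norm_divide)
  have \<zeta>z: "\<zeta> \<noteq> z" using \<zeta> r0 by auto
  have N1: "N w = 1 \<longleftrightarrow> w = \<zeta>" and Neq: "N w = N v \<longleftrightarrow> w = v" for w v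
    using \<zeta>z by (auto simp: N_def divide_eq_eq)
  define pos where "pos u = Re (cayley (N (s u)))" for u
  have inj_pos: "inj_on pos U"
  proof (rule inj_onI)
    fix u v assume uv: "u \<in> U" "v \<in> U" "pos u = pos v"
    have "norm (N (s u)) = 1" "norm (N (s v)) = 1" using uv s r0 by (auto simp: norm_N)
    \<comment> \<open>On the unit circle \<open>cayley\<close> is real, so its real part already
      determines the point.\<close>
    then have "Im (cayley (N (s u))) = Im (cayley (N (s v)))" by (simp add: Im_cayley)
    then have "cayley (N (s u)) = cayley (N (s v))" using uv by (simp add: complex_eq_iff pos_def)
    moreover have "N (s u) \<noteq> 1" "N (s v) \<noteq> 1" using \<zeta> uv by (auto simp: N1)
    ultimately have eq: "s u = s v" using cayley_inject Neq by blast
    show "u = v"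
    proof (rule ccontr)
      assume "u \<noteq> v"
      then have "s u \<in> p ` ({x, u} \<inter> {x, v})"
        using cross[OF U(1)[OF uv(1)] U(1)[OF uv(2)]] s(2)[OF uv(1)] s(2)[OF uv(2)] eq
        by (auto simp: doubleton_eq_iff)
      then have "s u = z" using \<open>u \<noteq> v\<close> by (auto simp: z_def)
      then show False using s(1)[OF uv(1)] r0 by simp
    qed
  qed
  have no_cross: False if AB: "A \<inter> B = {}" "x \<notin> A" "x \<notin> B" and la: "linked F A a c" and lb: "linked F B b d"
    and abcd: "{a, b, c, d} \<subseteq> U" and less: "pos a < pos b" "pos b < pos c" "pos c < pos d" for A B a b c d
  proof -
    \<comment> \<open>Besides staying outside the disc and off the cut, a good point remembers an
      edge on its own side, so that a meeting point can be traced back to two edges.\<close>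
    define good where "good A w \<longleftrightarrow> r \<le> norm (w - z) \<and> w \<noteq> \<zeta> \<and>
      (\<exists>e \<in> E. e \<subseteq> insert x A \<and> w \<in> path_image (\<gamma> e))" for A w
    have bridge: "\<exists>f. path f \<and> pathstart f = s a \<and> pathfinish f = s c \<and>
        (\<forall>w \<in> path_image f. good A w)"
      if ac: "a \<in> U" "c \<in> U" and l: "linked F A a c" for A a c
    proof -
      have A: "a \<in> A" "c \<in> A" using linked_in[OF l] by auto
      obtain g where g: "path g" "pathstart g = p a" "pathfinish g = p c"
        "path_image g \<subseteq> insert (p a) (\<Union>e\<in>{e\<in>F. e \<subseteq> A}. path_image (\<gamma> e))"
        using linked_path[OF drawing F(2) l] by metis
      have tailw: "good A w"
        if "w \<in> path_image (h u)" "u \<in> U" "u \<in> A" for w u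
      proof -
        have "r \<le> norm (w - z)" using h(6)[OF that(2,1)] .
        moreover have "w \<noteq> \<zeta>"
        proof
          assume "w = \<zeta>"
          then have "w = s u" using h(7)[OF that(2,1)] \<zeta>(1) by simp
          then show False using \<zeta>(2) \<open>w = \<zeta>\<close> that by blast
        qed
        moreover have "w \<in> path_image (\<gamma> {x, u})" using h(2)[OF that(2)] that(1) by blast
        moreover have "{x, u} \<in> E" "{x, u} \<subseteq> insert x A" using U(1)[OF that(2)] that(3) by auto
        ultimately show ?thesis unfolding good_def by blast
      qed
      have midw: "good A w"
        if wg: "w \<in> path_image g" for w
      proof (cases "w = p a")
        case True
        then have "w \<in> path_image (h a)" using h(3)[OF ac(1)] pathfinish_in_path_image[of "h a"] by simp
        then show ?thesis by (rule tailw[OF _ ac(1) A(1)])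
      next
        case False
        then obtain e where e: "e \<in> F" "e \<subseteq> A" "w \<in> path_image (\<gamma> e)" using g(4) wg by blast
        then have "w \<in> K" by (auto simp: K_def)
        then have "r < norm (w - z)" by (rule far)
        then have "r \<le> norm (w - z)" "w \<noteq> \<zeta>" using \<zeta>(1) by auto
        moreover have "e \<in> E" "e \<subseteq> insert x A" using e F(2) by auto
        ultimately show ?thesis unfolding good_def using e(3) by blast
      qed
      \<comment> \<open>Run along one tail from the circle to \<open>p a\<close>, then through the
        connection, then back along the other tail to the circle.\<close>
      let ?f = "h a +++ (g +++ reversepath (h c))"
      have "path ?f" "pathstart ?f = s a" "pathfinish ?f = s c"
        using g(1-3) h(1,3,4)[OF ac(1)] h(1,3,4)[OF ac(2)] by auto
      moreover have "path_image ?f = path_image (h a) \<union> (path_image g \<union> path_image (h c))"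
        using g(1-3) h(1,3,4)[OF ac(1)] h(1,3,4)[OF ac(2)] by (simp add: path_image_join)
      moreover have "good A w" if "w \<in> path_image (h a) \<union> (path_image g \<union> path_image (h c))" for w
        using that tailw[OF _ ac(1) A(1)] tailw[OF _ ac(2) A(2)] midw by auto
      ultimately show ?thesis by metis
    qed
    obtain f where f: "path f" "pathstart f = s a" "pathfinish f = s c"
      "\<And>w. w \<in> path_image f \<Longrightarrow> good A w"
      using bridge[OF _ _ la] abcd by auto
    obtain g where g: "path g" "pathstart g = s b" "pathfinish g = s d"
      "\<And>w. w \<in> path_image g \<Longrightarrow> good B w"
      using bridge[OF _ _ lb] abcd by auto
    have contN: "continuous_on S N" for S
      unfolding N_def using \<zeta>z by (intro continuous_intros) auto
    have "path_image (N \<circ> f) \<inter> path_image (N \<circ> g) \<noteq> {}"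
    proof (rule exterior_interlace)
      show "path (N \<circ> f)" "path (N \<circ> g)"
        using f(1) g(1) contN by (auto intro: path_continuous_image)
      show "1 \<le> norm w \<and> w \<noteq> 1" if "w \<in> path_image (N \<circ> f)" for w
        using that f(4) r0 N1 by (auto simp: path_image_compose norm_N good_def)
      show "1 \<le> norm w \<and> w \<noteq> 1" if "w \<in> path_image (N \<circ> g)" for w
        using that g(4) r0 N1 by (auto simp: path_image_compose norm_N good_def)
    qed (use f(2,3) g(2,3) s(1) abcd less r0 in
          \<open>simp_all add: pathstart_compose pathfinish_compose norm_N pos_def\<close>)
    then obtain w v where "w \<in> path_image f" "v \<in> path_image g" "N w = N v"
      unfolding path_image_compose by blast
    then have w: "w \<in> path_image f" "w \<in> path_image g" using Neq by auto
    obtain e e' where e: "e \<in> E" "e \<subseteq> insert x A" "w \<in> path_image (\<gamma> e)"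
      and e': "e' \<in> E" "e' \<subseteq> insert x B" "w \<in> path_image (\<gamma> e')" using f(4)[OF w(1)] g(4)[OF w(2)] unfolding good_def by blast
    \<comment> \<open>Two edges with at most \<open>x\<close> in common are different, so by the
      drawing their arcs meet at most in \<open>p x\<close>, which lies inside the disc.\<close>
    have sub: "e \<inter> e' \<subseteq> {x}" using e e' AB by blast
    have "e \<noteq> e'"
    proof
      assume "e = e'"
      then have "e \<subseteq> {x}" using sub by simp
      then have "card e \<le> 1" by (metis card.empty card_insert_disjoint card_mono empty_iff finite.emptyI finite_insert One_nat_def)
      then show False using edge[OF e(1)] by simp
    qed
    then have "w \<in> p ` (e \<inter> e')" using cross e e' by blast
    then have "w = z" using sub by (auto simp: z_def)
    then show False using f(4)[OF w(1)] r0 by (simp add: good_def)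
  qed
  show thesis
    by (rule that[OF inj_pos[unfolded U_def]]) (rule no_cross[unfolded U_def])
qed

section \<open>Curvature and Lipschitz test functions\<close>

lemma gdist_relpow:
  assumes "connected_graph V E" "u \<in> V" "v \<in> V"
  shows "(u, v) \<in> adj E ^^ gdist E u v"
proof -
  have "(u, v) \<in> (adj E)\<^sup>*"
    using assms by (simp add: connected_graph_def)
  then obtain n where "(u, v) \<in> adj E ^^ n"
    using rtrancl_power by blast
  then show ?thesis
    unfolding gdist_def by (rule LeastI)
qed

lemma gdist_ge_1:
  assumes "connected_graph V E" "u \<in> V" "v \<in> V" "u \<noteq> v"
  shows "1 \<le> gdist E u v"
proof (rule ccontr)
  assume "\<not> 1 \<le> gdist E u v"
  then have "gdist E u v = 0" by simp
  then show False using gdist_relpow[OF assms(1-3)] assms(4) by simp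
qed

lemma gdist_ge_2:
  assumes "connected_graph V E" "u \<in> V" "v \<in> V" "u \<noteq> v" "{u, v} \<notin> E"
  shows "2 \<le> gdist E u v"
proof -
  have "gdist E u v \<noteq> 1"
    using gdist_relpow[OF assms(1-3)] assms(5) by (auto simp: adj_def)
  then show ?thesis
    using gdist_ge_1[OF assms(1-4)] by simp
qed

lemma gdist_edge:
  assumes "{u, v} \<in> E" "u \<noteq> v"
  shows "gdist E u v = 1"
  unfolding gdist_def
proof (rule Least_equality)
  show "(u, v) \<in> adj E ^^ 1"
    using assms by (simp add: adj_def)
  show "1 \<le> n" if "(u, v) \<in> adj E ^^ n" for n
    using that assms(2) by (cases n) auto
qed

section \<open>Couplings, transport cost and lazy walks\<close>

lemma finite_coupling:
  assumes "A \<in> couplings m1 m2" "finite (set_pmf m1)" "finite (set_pmf m2)"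
  shows "finite (set_pmf A)" "set_pmf A \<subseteq> set_pmf m1 \<times> set_pmf m2"
proof -
  have "set_pmf m1 = fst ` set_pmf A" "set_pmf m2 = snd ` set_pmf A"
    using assms(1) by (auto simp: couplings_def set_map_pmf[symmetric] simp del: set_map_pmf)
  then show sub: "set_pmf A \<subseteq> set_pmf m1 \<times> set_pmf m2"
    by force
  then show "finite (set_pmf A)"
    using assms(2,3) finite_subset by blast
qed

text \<open>Bounds on an infimum of reals require a nonempty index set; the product measure provides
  a coupling.\<close>

lemma couplings_nonempty: "couplings m1 m2 \<noteq> {}"
proof -
  have "pair_pmf m1 m2 \<in> couplings m1 m2"
    by (simp add: couplings_def map_fst_pair_pmf map_snd_pair_pmf)
  then show ?thesis by blast
qed

abbreviation transport_cost :: "'a set set \<Rightarrow> ('a \<times> 'a) pmf \<Rightarrow> real" where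
  "transport_cost E A \<equiv> measure_pmf.expectation A (\<lambda>(u, v). real (gdist E u v))"

lemma bdd_below_transport_cost: "bdd_below (transport_cost E ` couplings m1 m2)"
  by (rule bdd_belowI2[where m = 0]) (auto intro!: integral_nonneg_AE)

text \<open>This is the easy half of Kantorovich duality: integrate the Lipschitz bound against any
  coupling. Finite supports make every function integrable.\<close>

lemma wasserstein_ge:
  assumes fin: "finite (set_pmf m1)" "finite (set_pmf m2)"
    and lip: "\<And>u v. u \<in> set_pmf m1 \<Longrightarrow> v \<in> set_pmf m2 \<Longrightarrow> f v - f u \<le> real (gdist E u v)"
  shows "measure_pmf.expectation m2 f - measure_pmf.expectation m1 f \<le> wasserstein E m1 m2"
  unfolding wasserstein_def
proof (rule cINF_greatest[OF couplings_nonempty])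
  fix A assume A: "A \<in> couplings m1 m2"
  note finA = finite_coupling[OF A fin]
  have int: "integrable (measure_pmf A) g" for g :: "_ \<Rightarrow> real"
    by (rule integrable_measure_pmf_finite[OF finA(1)])
  have "m1 = map_pmf fst A" "m2 = map_pmf snd A"
    using A by (auto simp: couplings_def)
  then have "measure_pmf.expectation m2 f - measure_pmf.expectation m1 f
      = measure_pmf.expectation A (\<lambda>p. f (snd p) - f (fst p))"
    by (simp add: int)
  also have "\<dots> \<le> transport_cost E A"
    using finA(2) lip by (intro integral_mono_AE int) (auto simp: AE_measure_pmf_iff)
  finally show "measure_pmf.expectation m2 f - measure_pmf.expectation m1 f \<le> transport_cost E A" .
qed

text \<open>The convex combination of \<open>p\<close> and \<open>q\<close> with weights
  \<open>c\<close> and \<open>1 - c\<close>, written as a two-stage experiment so that it commutes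
  with taking marginals.\<close>

definition mix_pmf :: "real \<Rightarrow> 'b pmf \<Rightarrow> 'b pmf \<Rightarrow> 'b pmf" where
  "mix_pmf c p q = bind_pmf (bernoulli_pmf c) (\<lambda>b. if b then p else q)"

lemma map_mix_pmf: "map_pmf g (mix_pmf c p q) = mix_pmf c (map_pmf g p) (map_pmf g q)"
  unfolding mix_pmf_def map_bind_pmf by (rule bind_pmf_cong) auto

lemma pmf_mix_pmf:
  assumes "0 \<le> c" "c \<le> 1"
  shows "pmf (mix_pmf c p q) z = c * pmf p z + (1 - c) * pmf q z"
  using assms by (simp add: mix_pmf_def pmf_bind)

lemma expectation_mix_pmf:
  fixes f :: "'b \<Rightarrow> real"
  assumes "0 \<le> c" "c \<le> 1" "finite (set_pmf p)" "finite (set_pmf q)"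
  shows "measure_pmf.expectation (mix_pmf c p q) f
    = c * measure_pmf.expectation p f + (1 - c) * measure_pmf.expectation q f"
  unfolding mix_pmf_def
  by (subst pmf_expectation_bind[where A = UNIV]) (use assms in \<open>auto simp: UNIV_bool\<close>)

text \<open>Mixing a coupling of \<open>m1\<close> and \<open>m2\<close> with the point mass at
  \<open>(x, y)\<close> gives a coupling of the mixtures.\<close>

lemma wasserstein_mix_le:
  assumes c: "0 < c" "c \<le> 1" and fin: "finite (set_pmf m1)" "finite (set_pmf m2)"
  shows "wasserstein E (mix_pmf c m1 (return_pmf x)) (mix_pmf c m2 (return_pmf y))
    \<le> c * wasserstein E m1 m2 + (1 - c) * real (gdist E x y)" (is "?W \<le> _")
proof -
  \<comment> \<open>Solving for the cost of the original coupling turns the claim into a lower bound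
    on an infimum.\<close>
  have "(?W - (1 - c) * real (gdist E x y)) / c \<le> wasserstein E m1 m2"
    unfolding wasserstein_def[of E m1 m2]
  proof (rule cINF_greatest[OF couplings_nonempty])
    fix A assume A: "A \<in> couplings m1 m2"
    let ?B = "mix_pmf c A (return_pmf (x, y))"
    have "?B \<in> couplings (mix_pmf c m1 (return_pmf x)) (mix_pmf c m2 (return_pmf y))"
      using A by (simp add: couplings_def map_mix_pmf)
    then have "?W \<le> transport_cost E ?B"
      unfolding wasserstein_def by (rule cINF_lower[OF bdd_below_transport_cost])
    also have "\<dots> = c * transport_cost E A + (1 - c) * real (gdist E x y)"
      using c finite_coupling[OF A fin] by (subst expectation_mix_pmf) auto
    finally show "(?W - (1 - c) * real (gdist E x y)) / c \<le> transport_cost E A"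
      using c by (simp add: field_simps)
  qed
  then show ?thesis
    using c by (simp add: field_simps)
qed

lemma finite_lazy_walk:
  assumes "finite (nbhd E x)" "nbhd E x \<noteq> {}"
  shows "finite (set_pmf (lazy_walk E \<alpha> x))"
  using assms by (auto simp: lazy_walk_def)

lemma set_lazy_walk:
  assumes "finite (nbhd E x)" "nbhd E x \<noteq> {}"
  shows "set_pmf (lazy_walk E \<alpha> x) \<subseteq> insert x (nbhd E x)"
  using set_pmf_of_set[OF assms(2,1)] by (auto simp: lazy_walk_def split: if_splits)

text \<open>A lazier walk is a less lazy one mixed with staying put; this reduces the dependence on
  laziness to a convexity argument.\<close>

lemma lazy_walk_mix:
  assumes "simple_graph V E" "finite (nbhd E x)" "nbhd E x \<noteq> {}" "0 \<le> \<alpha>" "\<alpha> \<le> \<beta>" "\<beta> < 1"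
  shows "lazy_walk E \<beta> x = mix_pmf ((1 - \<beta>) / (1 - \<alpha>)) (lazy_walk E \<alpha> x) (return_pmf x)"
proof (rule pmf_eqI)
  fix v
  define c where "c = (1 - \<beta>) / (1 - \<alpha>)"
  have c: "0 \<le> c" "c \<le> 1" "1 - \<beta> = c * (1 - \<alpha>)"
    using assms by (auto simp: c_def field_simps)
  have \<beta>: "\<beta> = c * \<alpha> + (1 - c)" using c(3) by (simp add: algebra_simps)
  have "pmf (lazy_walk E \<beta> x) v = c * pmf (lazy_walk E \<alpha> x) v + (1 - c) * pmf (return_pmf x) v"
    using assms c(3) \<beta> by (simp add: pmf_lazy_walk)
  then show "pmf (lazy_walk E \<beta> x) v
      = pmf (mix_pmf ((1 - \<beta>) / (1 - \<alpha>)) (lazy_walk E \<alpha> x) (return_pmf x)) v"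
    using pmf_mix_pmf[OF c(1,2)] unfolding c_def by metis
qed

lemma expectation_lazy_walk:
  fixes f :: "'a \<Rightarrow> real"
  assumes "simple_graph V E" "finite (nbhd E x)" "nbhd E x \<noteq> {}" "0 \<le> \<alpha>" "\<alpha> < 1"
  shows "measure_pmf.expectation (lazy_walk E \<alpha> x) f
    = \<alpha> * f x + (1 - \<alpha>) * ((\<Sum>v\<in>nbhd E x. f v) / real (degree E x))"
proof -
  have x: "x \<notin> nbhd E x"
    using assms(1) by (auto simp: simple_graph_def nbhd_def)
  have "measure_pmf.expectation (lazy_walk E \<alpha> x) f
      = (\<Sum>v\<in>insert x (nbhd E x). pmf (lazy_walk E \<alpha> x) v *\<^sub>R f v)"
    using set_lazy_walk[OF assms(2,3)] assms(2) by (intro integral_measure_pmf) auto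
  also have "\<dots> = \<alpha> * f x + (\<Sum>v\<in>nbhd E x. (1 - \<alpha>) / real (degree E x) * f v)"
    using assms x by (simp add: pmf_lazy_walk cong: sum.cong)
      (intro sum.cong, auto)
  also have "\<dots> = \<alpha> * f x + (1 - \<alpha>) * ((\<Sum>v\<in>nbhd E x. f v) / real (degree E x))"
    by (simp add: sum_distrib_left sum_divide_distrib)
  finally show ?thesis .
qed

text \<open>This monotonicity gives the existence of the limit in \<open>kappa_LLY\<close>, without which
  \<open>Lim\<close> would be an unspecified value.\<close>

lemma kappa_quotient_mono:
  assumes graph: "simple_graph V E" and fin: "locally_finite_graph V E"
    and xy: "{x, y} \<in> E" and \<alpha>: "0 \<le> \<alpha>" "\<alpha> \<le> \<beta>" "\<beta> < 1"
  shows "kappa E \<alpha> x y / (1 - \<alpha>) \<le> kappa E \<beta> x y / (1 - \<beta>)"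
proof -
  have V: "x \<in> V" "y \<in> V" "x \<noteq> y"
    using graph xy by (auto simp: simple_graph_def)
  have nb: "finite (nbhd E x)" "nbhd E x \<noteq> {}" "finite (nbhd E y)" "nbhd E y \<noteq> {}"
    using fin V xy by (auto simp: locally_finite_graph_def nbhd_def insert_commute)
  define c where "c = (1 - \<beta>) / (1 - \<alpha>)"
  have c: "0 < c" "c \<le> 1" "1 - \<beta> = c * (1 - \<alpha>)"
    using \<alpha> by (auto simp: c_def field_simps)
  have d: "gdist E x y = 1" using gdist_edge[OF xy V(3)] .
  have "wasserstein E (lazy_walk E \<beta> x) (lazy_walk E \<beta> y)
      \<le> c * wasserstein E (lazy_walk E \<alpha> x) (lazy_walk E \<alpha> y) + (1 - c)"
    using wasserstein_mix_le[OF c(1,2) finite_lazy_walk[OF nb(1,2), of \<alpha>] finite_lazy_walk[OF nb(3,4), of \<alpha>],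
        of E x y] d
      lazy_walk_mix[OF graph nb(1,2) \<alpha>] lazy_walk_mix[OF graph nb(3,4) \<alpha>]
    by (simp add: c_def)
  then have "c * kappa E \<alpha> x y \<le> kappa E \<beta> x y"
    by (simp add: kappa_def d algebra_simps)
  \<comment> \<open>Since \<open>1 - \<beta> = c * (1 - \<alpha>)\<close>, the factor
    \<open>c\<close> is exactly what the change of denominator absorbs.\<close>
  moreover have "kappa E \<alpha> x y / (1 - \<alpha>) = c * kappa E \<alpha> x y / (1 - \<beta>)"
    unfolding c(3) using c(1) by simp
  ultimately show ?thesis
    using \<alpha> by (simp add: divide_right_mono)
qed

text \<open>A bounded monotone function converges from the left to its supremum, so
  \<open>Lim\<close> is an actual limit here.\<close>

lemma Lim_at_left_le:
  fixes h :: "real \<Rightarrow> real"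
  assumes mono: "\<And>a b. l \<le> a \<Longrightarrow> a \<le> b \<Longrightarrow> b < r \<Longrightarrow> h a \<le> h b"
    and bound: "\<And>a. l \<le> a \<Longrightarrow> a < r \<Longrightarrow> h a \<le> B" and "l < r"
  shows "Lim (at_left r) h \<le> B"
proof -
  define L where "L = (SUP a\<in>{l..<r}. h a)"
  have ne: "{l..<r} \<noteq> {}" using \<open>l < r\<close> by simp
  have bdd: "bdd_above (h ` {l..<r})"
    using bound by (intro bdd_aboveI2[where M = B]) auto
  have "(h \<longlongrightarrow> L) (at_left r)"
  proof (rule order_tendstoI)
    fix c assume "c < L"
    then obtain a where a: "l \<le> a" "a < r" "c < h a"
      unfolding L_def less_cSUP_iff[OF ne bdd] by auto
    have "\<forall>\<^sub>F b in at_left r. b \<in> {a<..<r}"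
      using a(2) by (rule eventually_at_left_real)
    then show "\<forall>\<^sub>F b in at_left r. c < h b"
    proof (rule eventually_mono)
      fix b assume "b \<in> {a<..<r}"
      then have "h a \<le> h b" using a(1) by (intro mono) auto
      then show "c < h b" using a(3) by simp
    qed
  next
    fix c assume "L < c"
    have "\<forall>\<^sub>F b in at_left r. b \<in> {l<..<r}"
      using \<open>l < r\<close> by (rule eventually_at_left_real)
    then show "\<forall>\<^sub>F b in at_left r. h b < c"
    proof (rule eventually_mono)
      fix b assume "b \<in> {l<..<r}"
      then have "h b \<le> L" unfolding L_def by (intro cSUP_upper bdd) auto
      then show "h b < c" using \<open>L < c\<close> by simp
    qed
  qed
  then have "Lim (at_left r) h = L"
    by (intro tendsto_Lim) auto
  moreover have "L \<le> B"
    unfolding L_def using ne bound by (intro cSUP_least) auto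
  ultimately show ?thesis by simp
qed

text \<open>By duality every quotient in the limit is at most the same bound, independent of the
  laziness: the mass \<alpha> staying at the ends contributes exactly \<alpha>, as
  \<open>f y - f x = 1\<close>.\<close>

lemma kappa_LLY_le:
  assumes graph: "simple_graph V E" and conn: "connected_graph V E" and fin: "locally_finite_graph V E"
    and xy: "{x, y} \<in> E"
    and lip: "\<And>u v. u \<in> V \<Longrightarrow> v \<in> V \<Longrightarrow> f v - f u \<le> real (gdist E u v)"
    and f: "f x = 0" "f y = 1"
  shows "kappa_LLY E x y \<le> 1 + (\<Sum>u\<in>nbhd E x. f u) / real (degree E x)
      - (\<Sum>v\<in>nbhd E y. f v) / real (degree E y)" (is "_ \<le> ?B")
  unfolding kappa_LLY_def
proof (rule Lim_at_left_le[where l = 0])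
  fix \<alpha> \<beta> :: real assume "0 \<le> \<alpha>" "\<alpha> \<le> \<beta>" "\<beta> < 1"
  then show "kappa E \<alpha> x y / (1 - \<alpha>) \<le> kappa E \<beta> x y / (1 - \<beta>)"
    by (rule kappa_quotient_mono[OF graph fin xy])
next
  fix \<alpha> :: real assume \<alpha>: "0 \<le> \<alpha>" "\<alpha> < 1"
  have V: "x \<in> V" "y \<in> V" "x \<noteq> y"
    using graph xy by (auto simp: simple_graph_def)
  have nb: "finite (nbhd E x)" "nbhd E x \<noteq> {}" "finite (nbhd E y)" "nbhd E y \<noteq> {}"
    using fin V xy by (auto simp: locally_finite_graph_def nbhd_def insert_commute)
  have nbV: "nbhd E z \<subseteq> V" for z
    using graph by (auto simp: simple_graph_def nbhd_def)
  have "measure_pmf.expectation (lazy_walk E \<alpha> y) f - measure_pmf.expectation (lazy_walk E \<alpha> x) f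
      \<le> wasserstein E (lazy_walk E \<alpha> x) (lazy_walk E \<alpha> y)"
    using set_lazy_walk[OF nb(1,2), of \<alpha>] set_lazy_walk[OF nb(3,4), of \<alpha>] nbV[of x] nbV[of y] V
    by (intro wasserstein_ge finite_lazy_walk nb lip) auto
  then have "\<alpha> + (1 - \<alpha>) * ((\<Sum>v\<in>nbhd E y. f v) / real (degree E y))
        - (1 - \<alpha>) * ((\<Sum>u\<in>nbhd E x. f u) / real (degree E x))
      \<le> wasserstein E (lazy_walk E \<alpha> x) (lazy_walk E \<alpha> y)"
    using \<alpha> nb f by (simp add: expectation_lazy_walk[OF graph])
  then have "kappa E \<alpha> x y \<le> (1 - \<alpha>) * ?B"
    using gdist_edge[OF xy V(3)] by (simp add: kappa_def algebra_simps)
  then show "kappa E \<alpha> x y / (1 - \<alpha>) \<le> ?B"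
    using \<alpha> by (simp add: field_simps)
qed simp

text \<open>The test function is 1 on \<open>y\<close> and \<open>S\<close>, -1 on \<open>M\<close>
  and 0 elsewhere. \<open>C\<close> collects the neighbours of \<open>x\<close> reached from
  \<open>S\<close>, which cannot be given the value -1.\<close>

lemma curvature_inequality:
  assumes graph: "simple_graph V E" and conn: "connected_graph V E" and fin: "locally_finite_graph V E"
    and pos: "positively_curved E" and xy: "{x, y} \<in> E"
    and S: "S \<subseteq> nbhd E y - {x}" and "finite C"
    and C: "\<And>u s. u \<in> nbhd E x \<Longrightarrow> u \<noteq> y \<Longrightarrow> u \<notin> nbhd E y \<Longrightarrow> s \<in> S \<Longrightarrow> {s, u} \<in> E \<Longrightarrow> u \<in> C"
  shows "degree E x * card S
    < degree E y * (2 + card (nbhd E x \<inter> nbhd E y) + card (S \<inter> nbhd E x) + card C)"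
proof -
  have V: "x \<in> V" "y \<in> V" "x \<noteq> y"
    using graph xy by (auto simp: simple_graph_def)
  have nb: "finite (nbhd E x)" "finite (nbhd E y)" "y \<in> nbhd E x" "x \<in> nbhd E y"
    using fin V xy by (auto simp: locally_finite_graph_def nbhd_def insert_commute)
  have irrefl: "z \<notin> nbhd E z" for z
    using graph by (auto simp: simple_graph_def nbhd_def)
  have finS: "finite S" using S nb finite_subset by blast
  define M where "M = nbhd E x - insert y (nbhd E y \<union> C)"
  have finM: "finite M" using nb by (simp add: M_def)
  define f :: "'a \<Rightarrow> real" where "f v = (if v \<in> insert y S then 1 else if v \<in> M then - 1 else 0)" for v
  have SM: "insert y S \<inter> M = {}" using S by (auto simp: M_def)
  \<comment> \<open>This is the only place where the jump of 2 in the test function has to be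
    justified: no edge joins its two extreme level sets.\<close>
  have nonadj: "{u, v} \<notin> E" if "u \<in> M" "v \<in> insert y S" for u v
    using that C unfolding M_def nbhd_def by (auto simp: insert_commute)
  have lip: "f v - f u \<le> real (gdist E u v)" if "u \<in> V" "v \<in> V" for u v
  proof (cases "u = v")
    case False
    show ?thesis
    proof (cases "u \<in> M \<and> v \<in> insert y S")
      case True
      then have "2 \<le> gdist E u v"
        using gdist_ge_2[OF conn that False] nonadj by blast
      moreover have "f v = 1" "f u = - 1" using True SM by (auto simp: f_def)
      ultimately show ?thesis by simp
    next
      case nM: False
      then have "f v - f u \<le> 1" by (auto simp: f_def)
      then show ?thesis using gdist_ge_1[OF conn that False] by simp
    qed
  qed simp
  have fxy: "f x = 0" "f y = 1"
    using S V irrefl by (auto simp: f_def M_def)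
  have f_eq: "f v = indicator (insert y S) v - indicator M v" for v
    using SM by (auto simp: f_def indicator_def)
  have sum_f: "(\<Sum>v\<in>N. f v) = real (card (N \<inter> insert y S)) - real (card (N \<inter> M))" if "finite N" for N
    using that by (simp add: f_eq sum_subtractf indicator_def of_bool_def sum.If_cases Int_def)
  have "nbhd E y \<inter> insert y S = S" "nbhd E y \<inter> M = {}"
    using S irrefl by (auto simp: M_def)
  then have sum_y: "(\<Sum>v\<in>nbhd E y. f v) = real (card S)"
    using sum_f nb by simp
  have "nbhd E x \<inter> insert y S = insert y (S \<inter> nbhd E x)" "nbhd E x \<inter> M = M"
    using nb by (auto simp: M_def)
  moreover have "y \<notin> S" using S irrefl by blast
  ultimately have sum_x: "(\<Sum>v\<in>nbhd E x. f v) = 1 + real (card (S \<inter> nbhd E x)) - real (card M)"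
    using sum_f[OF nb(1)] finS by simp
  \<comment> \<open>The constant 2 in the bound comes from \<open>y\<close> alone: it is missing
    from \<open>M\<close>, and it has the value 1 in the sum around \<open>x\<close>.\<close>
  have "nbhd E x \<subseteq> M \<union> (insert y (nbhd E x \<inter> nbhd E y) \<union> C)"
    by (auto simp: M_def)
  then have "card (nbhd E x) \<le> card (M \<union> (insert y (nbhd E x \<inter> nbhd E y) \<union> C))"
    using finM nb \<open>finite C\<close> by (intro card_mono) auto
  also have "\<dots> \<le> card M + (card (insert y (nbhd E x \<inter> nbhd E y)) + card C)"
    by (meson card_Un_le add_left_mono le_trans)
  also have "\<dots> = card M + (1 + card (nbhd E x \<inter> nbhd E y) + card C)"
    using nb irrefl by simp
  finally have cardM: "degree E x \<le> card M + (1 + card (nbhd E x \<inter> nbhd E y) + card C)"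
    by (simp add: degree_def)
  have deg: "0 < degree E x" "0 < degree E y"
    using nb by (auto simp: degree_def card_gt_0_iff)
  have "0 < kappa_LLY E x y"
    using pos xy by (simp add: positively_curved_def)
  also have "\<dots> \<le> 1 + (1 + real (card (S \<inter> nbhd E x)) - real (card M)) / real (degree E x)
      - real (card S) / real (degree E y)"
    using kappa_LLY_le[OF graph conn fin xy lip fxy] sum_x sum_y by simp
  also have "\<dots> \<le> (2 + real (card (nbhd E x \<inter> nbhd E y)) + real (card (S \<inter> nbhd E x)) + real (card C)) / real (degree E x)
      - real (card S) / real (degree E y)"
  proof -
    have "1 + (1 + real (card (S \<inter> nbhd E x)) - real (card M)) / real (degree E x)
        = (real (degree E x) + (1 + real (card (S \<inter> nbhd E x)) - real (card M))) / real (degree E x)"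
      using deg by (simp add: field_simps)
    also have "\<dots> \<le> (2 + real (card (nbhd E x \<inter> nbhd E y)) + real (card (S \<inter> nbhd E x)) + real (card C)) / real (degree E x)"
      using cardM by (intro divide_right_mono) auto
    finally show ?thesis by simp
  qed
  finally have "real (card S) / real (degree E y)
      < (2 + real (card (nbhd E x \<inter> nbhd E y)) + real (card (S \<inter> nbhd E x)) + real (card C)) / real (degree E x)"
    by simp
  then have "real (card S) * real (degree E x)
      < (2 + real (card (nbhd E x \<inter> nbhd E y)) + real (card (S \<inter> nbhd E x)) + real (card C)) * real (degree E y)"
    using deg by (simp add: frac_less_eq divide_less_eq less_divide_eq field_simps)
  then have "real (degree E x * card S)
    < real (degree E y * (2 + card (nbhd E x \<inter> nbhd E y) + card (S \<inter> nbhd E x) + card C))"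
    by (simp add: algebra_simps)
  then show ?thesis
    using of_nat_less_iff by blast
qed

section \<open>The neighbourhood of a vertex of large degree\<close>

lemma card_le_1_if_subset_singleton: "A \<subseteq> {b} \<Longrightarrow> card A \<le> 1"
  using card_mono[of "{b}" A] by simp

text \<open>The neighbours of a vertex \<open>x\<close> of degree \<open>D\<close> are represented by their positions \<open>k < D\<close>.
  The neighbours of number \<open>k\<close> are \<open>x\<close>, the neighbours \<open>nb k\<close> of \<open>x\<close>, and the further vertices
  \<open>out k\<close>. Assumption \<open>curv\<close> is the curvature inequality for the edge from \<open>x\<close> to \<open>k\<close>
  with \<open>S\<close> consisting of \<open>T\<close> and \<open>W\<close>.\<close>

locale fan =
  fixes D :: nat and nb :: "nat \<Rightarrow> nat set" and out :: "nat \<Rightarrow> 'b set" and foot :: "'b \<Rightarrow> nat set"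
  defines "foot w \<equiv> {l. l < D \<and> w \<in> out l}"
  assumes D: "18 \<le> D"
    and nb_less: "k < D \<Longrightarrow> l \<in> nb k \<Longrightarrow> l < D"
    and nb_sym: "k < D \<Longrightarrow> l \<in> nb k \<Longrightarrow> k \<in> nb l"
    and nb_irrefl: "k < D \<Longrightarrow> k \<notin> nb k"
    and finite_out: "k < D \<Longrightarrow> finite (out k)"
    and deg: "k < D \<Longrightarrow> 2 \<le> card (nb k) + card (out k)"
    and curv: "\<lbrakk>k < D; T \<subseteq> nb k; W \<subseteq> out k; finite C;
        (\<Union>l\<in>T. nb l) \<subseteq> C \<union> insert k (nb k); (\<Union>w\<in>W. foot w) \<subseteq> C \<union> insert k (nb k)\<rbrakk>
      \<Longrightarrow> 18 * (card T + card W) < (1 + card (nb k) + card (out k)) * (2 + card (nb k) + card T + card C)"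
    and nc_edges: "\<lbrakk>a < b; b < c; c < d; d < D; c \<in> nb a; d \<in> nb b\<rbrakk> \<Longrightarrow> False"
    and nc_edge_out: "\<lbrakk>a < b; b < c; c < d; d < D; c \<in> nb a; w \<in> out b; w \<in> out d\<rbrakk> \<Longrightarrow> False"
    and nc_out_edge: "\<lbrakk>a < b; b < c; c < d; d < D; w \<in> out a; w \<in> out c; d \<in> nb b\<rbrakk> \<Longrightarrow> False"
    and nc_outs: "\<lbrakk>a < b; b < c; c < d; d < D; w \<in> out a; w \<in> out c; w' \<in> out b; w' \<in> out d; w \<noteq> w'\<rbrakk> \<Longrightarrow> False"
begin

section \<open>Separating pairs and ears\<close>

definition sep :: "nat \<Rightarrow> nat \<Rightarrow> bool" where
  "sep i j \<longleftrightarrow> (\<forall>k l. i < k \<longrightarrow> k < j \<longrightarrow> l < D \<longrightarrow> l < i \<or> j < l \<longrightarrow> l \<notin> nb k \<and> out k \<inter> out l = {})"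

lemma sep_nb:
  assumes "sep i j" "i < k" "k < j" "j < D" "l \<in> nb k"
  shows "i \<le> l \<and> l \<le> j"
proof -
  have "l < D" using nb_less[of k l] assms by simp
  then have "\<not> (l < i \<or> j < l)" using assms unfolding sep_def by blast
  then show ?thesis by simp
qed

lemma sep_foot:
  assumes "sep i j" "i < k" "k < j" "j < D" "w \<in> out k" "l \<in> foot w"
  shows "i \<le> l \<and> l \<le> j"
proof -
  have "l < D" "w \<in> out l" using assms by (simp_all add: foot_def)
  then have "\<not> (l < i \<or> j < l)" using assms unfolding sep_def by blast
  then show ?thesis by simp
qed

lemma finite_nb:
  assumes "k < D"
  shows "finite (nb k)"
proof (rule finite_subset)
  show "nb k \<subseteq> {..<D}" using nb_less[OF assms] by blast
qed simp

text \<open>Anything leading from the interior of the pair to its exterior would interleave with the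
  edge between \<open>i\<close> and \<open>j\<close>.\<close>

lemma sep_edge:
  assumes "i < j" "j < D" "j \<in> nb i"
  shows "sep i j"
  unfolding sep_def
proof (intro allI impI)
  fix k l assume k: "i < k" "k < j" and l: "l < D" "l < i \<or> j < l"
  have kD: "k < D" using k assms by simp
  show "l \<notin> nb k \<and> out k \<inter> out l = {}"
  proof (cases "l < i")
    case True
    then have "k \<in> nb l \<Longrightarrow> False" using nc_edges[of l i k j] k assms by blast
    then have "l \<notin> nb k" using nb_sym kD by blast
    moreover have "w \<in> out l \<Longrightarrow> w \<in> out k \<Longrightarrow> False" for w
      using nc_out_edge[of l i k j w] True k assms by blast
    ultimately show ?thesis by blast
  next
    case False
    then have "j < l" using l by simp
    then show ?thesis
      using nc_edges[of i k j l] nc_edge_out[of i k j l] k l assms by blast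
  qed
qed

text \<open>As for an edge, with the path through \<open>w\<close> as barrier. Non-crossing says
  nothing about connections through \<open>w\<close> itself, so these are excluded by
  assumption.\<close>

lemma sep_out:
  assumes ij: "i < j" "j < D" "w \<in> out i" "w \<in> out j"
    and w: "\<And>k l. \<lbrakk>i < k; k < j; l < i \<or> j < l; w \<in> out k; w \<in> out l; l < D\<rbrakk> \<Longrightarrow> False"
  shows "sep i j"
  unfolding sep_def
proof (intro allI impI)
  fix k l assume k: "i < k" "k < j" and l: "l < D" "l < i \<or> j < l"
  have kD: "k < D" using k assms by simp
  show "l \<notin> nb k \<and> out k \<inter> out l = {}"
  proof (cases "l < i")
    case True
    then have "k \<in> nb l \<Longrightarrow> False" using nc_edge_out[of l i k j w] k ij by blast
    then have "l \<notin> nb k" using nb_sym kD by blast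
    moreover have "v \<in> out l \<Longrightarrow> v \<in> out k \<Longrightarrow> False" for v
      using nc_outs[of l i k j v w] w[of k l] True k l ij by blast
    ultimately show ?thesis by blast
  next
    case False
    then have l': "j < l" using l by simp
    have "l \<notin> nb k" using nc_out_edge[of i k j l w] k l l' ij by blast
    moreover have "v \<in> out l \<Longrightarrow> v \<in> out k \<Longrightarrow> False" for v
      using nc_outs[of i k j l w v] w[of k l] l' k l ij by blast
    ultimately show ?thesis by blast
  qed
qed

text \<open>Take \<open>T\<close> empty and \<open>W\<close> all of \<open>out (k + 1)\<close>. The
  second factor becomes 4, so with n outer neighbours 18 n < 4 (3 + n), hence n = 0. The degree
  condition then forces both possible neighbours.\<close>

lemma ear:
  assumes "sep k (k + 2)" "k + 2 < D"
  shows "nb (k + 1) = {k, k + 2}" "out (k + 1) = {}"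
proof -
  let ?e = "k + 1"
  have e: "?e < D" "k < ?e" "?e < k + 2" using assms by auto
  have nb: "nb ?e \<subseteq> {k, k + 2}"
  proof
    fix l assume l: "l \<in> nb ?e"
    then have "k \<le> l" "l \<le> k + 2" "l \<noteq> ?e"
      using sep_nb[OF assms(1) e(2,3) assms(2) l] nb_irrefl[OF e(1)] by auto
    then show "l \<in> {k, k + 2}" by auto
  qed
  have ft: "foot w \<subseteq> {k, k + 1, k + 2}" if "w \<in> out ?e" for w
    using sep_foot[OF assms(1) e(2,3) assms(2) that] by force
  have cC: "card ({k, k + 2} - nb ?e) = 2 - card (nb ?e)"
    using nb by (simp add: card_Diff_subset finite_subset)
  have t: "card (nb ?e) \<le> 2"
    using card_mono[OF _ nb] by simp
  have "18 * (card ({} :: nat set) + card (out ?e))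
      < (1 + card (nb ?e) + card (out ?e)) * (2 + card (nb ?e) + card ({} :: nat set) + card ({k, k + 2} - nb ?e))"
    by (rule curv) (use e ft in auto)
  also have "2 + card (nb ?e) + card ({} :: nat set) + card ({k, k + 2} - nb ?e) = 4"
    using cC t by simp
  finally have "card (out ?e) = 0" using t by simp
  then show "out ?e = {}" using finite_out e by simp
  then have "2 \<le> card (nb ?e)" using deg[OF e(1)] by simp
  then show "nb ?e = {k, k + 2}" using nb by (intro card_seteq) auto
qed

text \<open>The ear has degree 3, so the curvature inequality reads 18 |T| < 3 (4 + |T| + |C|). One
  end as \<open>T\<close> gives |C| \<ge> 2, both ends give |C| \<ge> 7.\<close>

lemma ear_conditions:
  assumes "sep k (k + 2)" "k + 2 < D"
  shows "2 \<le> card (nb k - {k + 1, k + 2})"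
    "2 \<le> card (nb (k + 2) - {k + 1, k})"
    "7 \<le> card (nb k \<union> nb (k + 2) - {k, k + 1, k + 2})"
proof -
  note e = ear[OF assms]
  have fin: "finite (nb k)" "finite (nb (k + 2))" using finite_nb assms by auto
  have c: "18 * card T < 3 * (4 + card T + card C)"
    if "T \<subseteq> {k, k + 2}" "finite C" "(\<Union>l\<in>T. nb l) \<subseteq> C \<union> {k, k + 1, k + 2}" for T C
    using curv[of "k + 1" T "{}" C] that assms e by (auto simp: insert_commute)
  have "18 * card {k} < 3 * (4 + card {k} + card (nb k - {k + 1, k + 2}))"
    by (rule c) (use fin in auto)
  then show "2 \<le> card (nb k - {k + 1, k + 2})" by simp
  have "18 * card {k + 2} < 3 * (4 + card {k + 2} + card (nb (k + 2) - {k + 1, k}))"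
    by (rule c) (use fin in auto)
  then show "2 \<le> card (nb (k + 2) - {k + 1, k})" by simp
  have "18 * card {k, k + 2} < 3 * (4 + card {k, k + 2} + card (nb k \<union> nb (k + 2) - {k, k + 1, k + 2}))"
    by (rule c) (use fin in auto)
  then show "7 \<le> card (nb k \<union> nb (k + 2) - {k, k + 1, k + 2})" by simp
qed

text \<open>Any \<open>w\<close> outside that meets the interior of the pair is either adjacent to all of
  \<open>{i..j}\<close>, and there is at most one such \<open>w\<close>, or only to one vertex or two consecutive ones.\<close>

lemma no_minimal_polygon:
  assumes sep: "sep i j" "j < D" "i + 3 \<le> j"
    and sub: "\<And>k l. \<lbrakk>i \<le> k; k < l; l \<le> j; sep k l; (k, l) \<noteq> (i, j)\<rbrakk> \<Longrightarrow> l = k + 1"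
  shows False
proof -
  have nb: "nb p \<subseteq> {p - 1, p + 1}" if p: "i < p" "p < j" for p
  proof
    fix l assume l: "l \<in> nb p"
    have pD: "p < D" using p sep by simp
    have il: "i \<le> l" "l \<le> j" using sep_nb[OF sep(1) p sep(2) l] by auto
    have "l \<noteq> p" using l nb_irrefl[OF pD] by blast
    then consider "l < p" | "p < l" by linarith
    then show "l \<in> {p - 1, p + 1}"
    proof cases
      case 1
      then have "sep l p" using sep_edge pD nb_sym[OF pD l] by blast
      then show ?thesis using sub[of l p] 1 il p by auto
    next
      case 2
      then have "sep p l" using sep_edge il l sep by auto
      then show ?thesis using sub[of p l] 2 il p by auto
    qed
  qed
  have foot: "foot w = {i..j} \<or> foot w \<subseteq> {p - 1, p, p + 1}" if p: "i < p" "p < j" and w: "w \<in> out p" for p w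
  proof -
    have foot_sub: "foot w \<subseteq> {i..j}"
      using sep_foot[OF sep(1) p sep(2) w] by auto
    have fin: "finite (foot w)" by (simp add: foot_def)
    have pf: "p \<in> foot w" using w p sep by (simp add: foot_def)
    define m M where "m = Min (foot w)" and "M = Max (foot w)"
    have mM: "m \<in> foot w" "M \<in> foot w" "\<And>l. l \<in> foot w \<Longrightarrow> m \<le> l \<and> l \<le> M"
      using fin pf unfolding m_def M_def by (auto intro: Min_in Max_in)
    show ?thesis
    proof (cases "(m, M) = (i, j)")
      case False
      have "M \<le> m + 1"
      proof (cases "m < M")
        case True
        \<comment> \<open>All feet of \<open>w\<close> lie between the extreme ones, so
          \<open>w\<close> cannot lead out of this pair.\<close>
        have "sep m M"
          by (rule sep_out[of m M w]) (use True mM foot_def in force)+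
        then show ?thesis using sub[of m M] True False mM foot_sub by force
      qed simp
      then have "foot w \<subseteq> {p - 1, p, p + 1}" using mM(3) mM(3)[OF pf] by fastforce
      then show ?thesis ..
    next
      case True
      have "q \<in> foot w" if q: "q \<in> {i..j}" for q
      proof (rule ccontr)
        assume nq: "q \<notin> foot w"
        have iq: "i \<in> foot w" "j \<in> foot w" using True mM by auto
        \<comment> \<open>The feet of \<open>w\<close> next to the missing \<open>q\<close> form a
          separating pair with a gap, although a proper pair must consist of consecutive
          positions.\<close>
        define k l where "k = Max {r \<in> foot w. r < q}" and "l = Min {r \<in> foot w. q < r}"
        have qij: "i < q" "q < j" using q nq iq by (metis atLeastAtMost_iff le_neq_implies_less)+
        have fins: "finite {r \<in> foot w. r < q}" "finite {r \<in> foot w. q < r}" using fin by auto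
        have ne: "{r \<in> foot w. r < q} \<noteq> {}" "{r \<in> foot w. q < r} \<noteq> {}" using qij iq by auto
        have k: "k \<in> foot w" "k < q" "\<And>r. r \<in> foot w \<Longrightarrow> r < q \<Longrightarrow> r \<le> k"
          using Max_in[OF fins(1) ne(1)] Max_ge[OF fins(1)] by (auto simp: k_def)
        have l: "l \<in> foot w" "q < l" "\<And>r. r \<in> foot w \<Longrightarrow> q < r \<Longrightarrow> l \<le> r"
          using Min_in[OF fins(2) ne(2)] Min_le[OF fins(2)] by (auto simp: l_def)
        have gap: "r \<notin> foot w" if "k < r" "r < l" for r
          using k(3)[of r] l(3)[of r] nq that by (metis linorder_neqE_nat not_le)
        have kl: "k < l" "l < D" "i \<le> k" "l \<le> j"
          using k(1,2) l(1,2) subsetD[OF foot_sub k(1)] subsetD[OF foot_sub l(1)] by (simp_all add: foot_def)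
        have "sep k l"
          by (rule sep_out[of k l w]) (use kl k(1) l(1) gap in \<open>auto simp: foot_def\<close>)
        moreover have "(k, l) \<noteq> (i, j)" using gap pf p by auto
        ultimately show False using sub[of k l] kl k l by auto
      qed
      then show ?thesis using foot_sub by blast
    qed
  qed
  have hub_unique: "w = w'" if "foot w = {i..j}" "foot w' = {i..j}" for w w'
  proof (rule ccontr)
    assume "w \<noteq> w'"
    moreover have "i \<in> foot w" "i + 2 \<in> foot w" "i + 1 \<in> foot w'" "i + 3 \<in> foot w'"
      using that sep(3) by simp_all
    then have "w \<in> out i" "w \<in> out (i + 2)" "w' \<in> out (i + 1)" "w' \<in> out (i + 3)"
      unfolding foot_def by simp_all
    ultimately show False
      using nc_outs[of i "i + 1" "i + 2" "i + 3" w w'] sep by simp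
  qed
  \<comment> \<open>Every interior vertex sees the hub, the unique outer vertex adjacent to all of
    \<open>{i..j}\<close>. The local outer neighbours \<open>W\<close> have all their feet next to
    \<open>p\<close>, so the second factor is 4 again and \<open>W\<close> is tiny.\<close>
  have shape: "\<exists>w W. foot w = {i..j} \<and> w \<notin> W \<and> out p = insert w W \<and> finite W \<and>
      (\<forall>v\<in>W. foot v \<subseteq> {p - 1, p, p + 1}) \<and>
      (card (nb p) = 1 \<and> W = {} \<or> card (nb p) = 2 \<and> card W \<le> 1)" if p: "i < p" "p < j" for p
  proof -
    have pD: "p < D" using p sep by simp
    define W where "W = {w \<in> out p. foot w \<noteq> {i..j}}"
    have finW: "finite W" using finite_out[OF pD] by (simp add: W_def)
    have Wfoot: "foot v \<subseteq> {p - 1, p, p + 1}" if "v \<in> W" for v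
      using foot[OF p] that by (auto simp: W_def)
    have t: "card (nb p) \<le> 2"
      using card_mono[OF _ nb[OF p]] p by simp
    have cC: "card ({p - 1, p + 1} - nb p) = 2 - card (nb p)"
      using nb[OF p] p by (simp add: card_Diff_subset finite_subset)
    have "18 * (card ({} :: nat set) + card W)
        < (1 + card (nb p) + card (out p)) * (2 + card (nb p) + card ({} :: nat set) + card ({p - 1, p + 1} - nb p))"
      by (rule curv[OF pD]) (use Wfoot in \<open>auto simp: W_def\<close>)
    also have "2 + card (nb p) + card ({} :: nat set) + card ({p - 1, p + 1} - nb p) = 4"
      using cC t by simp
    finally have main: "18 * card W < (1 + card (nb p) + card (out p)) * 4" by simp
    have "\<exists>w \<in> out p. foot w = {i..j}"
    proof (rule ccontr)
      assume "\<not> ?thesis"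
      then have "W = out p" by (auto simp: W_def)
      then have "card (out p) = 0" using main t by simp
      then have t2: "card (nb p) = 2" "out p = {}" using deg[OF pD] t finite_out[OF pD] by auto
      then have nbp: "nb p = {p - 1, p + 1}" using nb[OF p] p by (intro card_seteq) auto
      \<comment> \<open>Without a hub \<open>p\<close> has degree 3, and testing with one interior
        neighbour \<open>q\<close> gives 18 < 3 * 6.\<close>
      obtain q where q: "q \<in> nb p" "i < q" "q < j"
        using nbp p sep(3) by (cases "p + 1 < j") (auto intro: that[of "p + 1"] that[of "p - 1"])
      have "card (nb q - {p}) \<le> 1"
      proof -
        have "p \<in> {q - 1, q + 1}" using nb[OF q(2,3)] nb_sym[OF pD q(1)] by blast
        then have "nb q - {p} \<subseteq> {if p = q - 1 then q + 1 else q - 1}" using nb[OF q(2,3)] by auto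
        then show ?thesis by (rule card_le_1_if_subset_singleton)
      qed
      moreover have "18 * (card {q} + card ({} :: 'b set))
          < (1 + card (nb p) + card (out p)) * (2 + card (nb p) + card {q} + card (nb q - {p}))"
        by (rule curv[OF pD]) (use q finite_nb[of q] sep in auto)
      ultimately show False using t2 by simp
    qed
    then obtain w where w: "w \<in> out p" "foot w = {i..j}" by blast
    have out: "out p = insert w W" and wW: "w \<notin> W" using w hub_unique by (auto simp: W_def)
    have co: "card (out p) = 1 + card W" using out wW finW by simp
    have "card (nb p) = 0 \<or> card (nb p) = 1 \<or> card (nb p) = 2" using t by linarith
    then have "card (nb p) = 1 \<and> card W = 0 \<or> card (nb p) = 2 \<and> card W \<le> 1"
      using main co deg[OF pD] by auto
    then show ?thesis using w out wW finW Wfoot by (intro exI[of _ w] exI[of _ W]) auto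
  qed
  show False
  proof (cases "i + 4 \<le> j")
    case True
    \<comment> \<open>Both vertices next to \<open>p\<close> are interior and reach little. The hub
      stays out of the test set because its feet may be numerous.\<close>
    define p where "p = i + 2"
    have p: "i < p" "p < j" "p < D" using True sep by (auto simp: p_def)
    obtain w W where w: "foot w = {i..j}" "w \<notin> W" "out p = insert w W" "finite W"
      "\<forall>v\<in>W. foot v \<subseteq> {p - 1, p, p + 1}"
      and alt: "card (nb p) = 1 \<and> W = {} \<or> card (nb p) = 2 \<and> card W \<le> 1"
      using shape[OF p(1,2)] by metis
    have co: "card (out p) = 1 + card W" using w by simp
    have nb1: "nb (p - 1) \<subseteq> {p - 2, p}" and nb2: "nb (p + 1) \<subseteq> {p, p + 2}"
      using nb[of "p - 1"] nb[of "p + 1"] True by (auto simp: p_def)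
    from alt show False
    proof
      assume A: "card (nb p) = 1 \<and> W = {}"
      then obtain y where y: "nb p = {y}" by (metis card_1_singletonE)
      have "card (nb y - {p}) \<le> 1"
      proof -
        have "y = p - 1 \<or> y = p + 1" using y nb[OF p(1,2)] by auto
        then have "nb y - {p} \<subseteq> {p - 2} \<or> nb y - {p} \<subseteq> {p + 2}" using nb1 nb2 by auto
        then show ?thesis by (elim disjE) (erule card_le_1_if_subset_singleton)+
      qed
      moreover have "18 * (card {y} + card ({} :: 'b set))
          < (1 + card (nb p) + card (out p)) * (2 + card (nb p) + card {y} + card (nb y - {p}))"
        by (rule curv[OF p(3)]) (use y finite_nb[of y] nb_less[OF p(3), of y] in auto)
      ultimately show False using A co by simp
    next
      assume A: "card (nb p) = 2 \<and> card W \<le> 1"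
      then have nbp: "nb p = {p - 1, p + 1}" using nb[OF p(1,2)] by (intro card_seteq) auto
      have "18 * (card {p - 1, p + 1} + card W)
          < (1 + card (nb p) + card (out p)) * (2 + card (nb p) + card {p - 1, p + 1} + card {p - 2, p + 2})"
        by (rule curv[OF p(3)]) (use nbp w nb1 nb2 in auto)
      moreover have "card {p - 2, p + 2} \<le> 2" by (simp add: card_insert_if)
      moreover have "card {p - 1, p + 1} = 2" by simp
      ultimately have "18 * (2 + card W) < (4 + card W) * 8"
        using A co by (simp add: p_def)
      then show False by simp
    qed
  next
    case False
    then have j: "j = i + 3" using sep by simp
    \<comment> \<open>Now \<open>i\<close> is adjacent in position to \<open>p\<close> and may have
      neighbours outside the pair, so it stays out of the test set. The hub has only four feet and
      is included instead.\<close>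
    define p where "p = i + 1"
    have p: "i < p" "p < j" "p < D" using j sep by (auto simp: p_def)
    obtain w W where w: "foot w = {i..j}" "w \<notin> W" "out p = insert w W" "finite W"
      "\<forall>v\<in>W. foot v \<subseteq> {p - 1, p, p + 1}"
      and alt: "card (nb p) = 1 \<and> W = {} \<or> card (nb p) = 2 \<and> card W \<le> 1"
      using shape[OF p(1,2)] by metis
    have co: "card (out p) = 1 + card W" using w by simp
    have ivl: "{i..j} = {i, i + 1, i + 2, i + 3}" using j by auto
    from alt show False
    proof
      assume A: "card (nb p) = 1 \<and> W = {}"
      then obtain y where y: "nb p = {y}" by (metis card_1_singletonE)
      have "y = i \<or> y = i + 2" using y nb[OF p(1,2)] by (auto simp: p_def)
      then have py: "{p, y} \<subseteq> {i..j}" "p \<noteq> y" using j by (auto simp: p_def)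
      have "card (foot w - {p, y}) = card {i..j} - card {p, y}"
        unfolding w(1) by (rule card_Diff_subset) (use py in simp_all)
      then have "card (foot w - {p, y}) = 2" using j py(2) by simp
      moreover have "18 * (card ({} :: nat set) + card {w})
          < (1 + card (nb p) + card (out p)) * (2 + card (nb p) + card ({} :: nat set) + card (foot w - {p, y}))"
        by (rule curv[OF p(3)]) (use y w in auto)
      ultimately show False using A co by simp
    next
      assume A: "card (nb p) = 2 \<and> card W \<le> 1"
      then have nbp: "nb p = {p - 1, p + 1}" using nb[OF p(1,2)] by (intro card_seteq) auto
      have nb2: "nb (p + 1) \<subseteq> {p, p + 2}" using nb[of "p + 1"] j by (auto simp: p_def)
      have "18 * (card {p + 1} + card (out p))
          < (1 + card (nb p) + card (out p)) * (2 + card (nb p) + card {p + 1} + card {p + 2})"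
        by (rule curv[OF p(3)]) (use nbp w nb2 ivl in \<open>auto simp: p_def\<close>)
      then have "18 * (2 + card W) < (4 + card W) * 6" using A co by simp
      then show False by simp
    qed
  qed
qed

text \<open>An ear exists, as otherwise \<open>no_minimal_polygon\<close> applies. It must touch an
  end of the pair; its other end then needs a second ear on the far side, which touches the other
  end of the pair. Hence the length 4.\<close>

lemma minimal_with_ears:
  assumes sep: "sep i j" "j < D" "i + 3 \<le> j"
    and sub: "\<And>k l. \<lbrakk>i \<le> k; k < l; l \<le> j; sep k l; (k, l) \<noteq> (i, j)\<rbrakk> \<Longrightarrow> l \<le> k + 2"
  shows "j = i + 4" "5 \<le> card (nb i - {i + 1, i + 2, i + 4})" "5 \<le> card (nb j - {i + 3, i + 2, i})"
proof -
  have nb: "l \<in> {p - 2, p - 1, p + 1, p + 2}" "l < p \<Longrightarrow> sep l p" "p < l \<Longrightarrow> sep p l" "i \<le> l" "l \<le> j"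
    if p: "i < p" "p < j" and l: "l \<in> nb p" for p l
  proof -
    have pD: "p < D" using p sep by simp
    show il: "i \<le> l" "l \<le> j" using sep_nb[OF sep(1) p sep(2) l] by auto
    show 1: "sep l p" if "l < p" using sep_edge pD nb_sym[OF pD l] that by blast
    show 2: "sep p l" if "p < l" using sep_edge il l sep that by auto
    have "l \<noteq> p" using l nb_irrefl[OF pD] by blast
    then consider "l < p" | "p < l" by linarith
    then show "l \<in> {p - 2, p - 1, p + 1, p + 2}"
    proof cases
      case c: 1
      then show ?thesis using sub[of l p] 1 il p by auto
    next
      case c: 2
      then show ?thesis using sub[of p l] 2 il p by auto
    qed
  qed
  \<comment> \<open>If both ends of the ear were interior, they would have at most four further
    neighbours, while seven are required.\<close>
  have touch: "k = i \<or> k + 2 = j" if k: "i \<le> k" "k + 2 \<le> j" "sep k (k + 2)" for k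
  proof (rule ccontr)
    assume "\<not> ?thesis"
    then have "nb k \<union> nb (k + 2) - {k, k + 1, k + 2} \<subseteq> {k - 2, k - 1, k + 3, k + 4}"
      using nb(1)[of k] nb(1)[of "k + 2"] k by fastforce
    then have "card (nb k \<union> nb (k + 2) - {k, k + 1, k + 2}) \<le> card {k - 2, k - 1, k + 3, k + 4}"
      by (intro card_mono) auto
    also have "\<dots> \<le> 4" by (simp add: card_insert_if)
    finally show False using ear_conditions(3)[of k] k sep by simp
  qed
  obtain k where k: "i \<le> k" "k + 2 \<le> j" "sep k (k + 2)"
  proof -
    have "\<not> (\<forall>k l. i \<le> k \<longrightarrow> k < l \<longrightarrow> l \<le> j \<longrightarrow> sep k l \<longrightarrow> (k, l) \<noteq> (i, j) \<longrightarrow> l = k + 1)"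
      using no_minimal_polygon[OF sep] by blast
    then obtain k l where kl: "i \<le> k" "k < l" "l \<le> j" "sep k l" "(k, l) \<noteq> (i, j)" "l \<noteq> k + 1" by blast
    then have "l = k + 2" using sub[of k l] by simp
    then show thesis using that kl by blast
  qed
  have two: "a \<in> A" if "2 \<le> card A" "A \<subseteq> {a, b}" for a b :: nat and A
  proof (rule ccontr)
    assume "a \<notin> A"
    then have "A \<subseteq> {b}" using that by auto
    then have "card A \<le> 1" by (rule card_le_1_if_subset_singleton)
    then show False using that by simp
  qed
  have both: "j = i + 4 \<and> sep i (i + 2) \<and> sep (i + 2) (i + 4)"
  proof (cases "k = i")
    case True
    have v: "i < i + 2" "i + 2 < j" using sep by auto
    have "i + 4 \<in> nb (i + 2) - {i + 1, i}"
    proof (rule two)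
      show "2 \<le> card (nb (i + 2) - {i + 1, i})" using ear_conditions(2)[of i] k sep True by simp
      show "nb (i + 2) - {i + 1, i} \<subseteq> {i + 4, i + 3}" using nb(1)[OF v] by fastforce
    qed
    then have "sep (i + 2) (i + 4)" "i + 4 \<le> j" using nb(3,5)[OF v, of "i + 4"] by auto
    moreover have "i + 2 + 2 = i + 4" by simp
    ultimately show ?thesis using touch[of "i + 2"] k True by (metis add_cancel_right_right le_add1 zero_neq_numeral)
  next
    case False
    then have kj: "k + 2 = j" using touch k by blast
    have v: "i < k" "k < j" using False k by auto
    have "k - 2 \<in> nb k - {k + 1, k + 2}"
    proof (rule two)
      show "2 \<le> card (nb k - {k + 1, k + 2})" using ear_conditions(1)[of k] k sep by simp
      show "nb k - {k + 1, k + 2} \<subseteq> {k - 2, k - 1}" using nb(1)[OF v] by fastforce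
    qed
    then have *: "k - 2 \<in> nb k" by simp
    have "sep (k - 2) k" "i \<le> k - 2" using nb(2,4)[OF v *] v by auto
    \<comment> \<open>This guards against truncated subtraction: for \<open>k = 1\<close> the
      positions \<open>k - 2\<close> and \<open>k - 1\<close> coincide and cannot supply two
      neighbours.\<close>
    moreover have "2 \<le> k"
    proof (rule ccontr)
      assume "\<not> 2 \<le> k"
      then have "nb k - {k + 1, k + 2} \<subseteq> {k - 1}" using nb(1)[OF v] nb_irrefl[of k] v sep by fastforce
      then have "card (nb k - {k + 1, k + 2}) \<le> 1" by (rule card_le_1_if_subset_singleton)
      then show False using ear_conditions(1)[of k] k sep by simp
    qed
    moreover from this have "k - 2 + 2 = k" by simp
    ultimately have "k - 2 = i" using touch[of "k - 2"] v by (metis less_imp_le_nat nat_less_le)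
    then have "k = i + 2" using \<open>2 \<le> k\<close> by simp
    then show ?thesis using kj k \<open>sep (k - 2) k\<close> by (simp add: eval_nat_numeral)
  qed
  show j: "j = i + 4" using both by simp
  have mid: "nb (i + 2) \<subseteq> {i, i + 1, i + 3, i + 4}"
    using nb(1)[of "i + 2"] j by fastforce
  have fin: "finite (nb i)" "finite (nb j)" using finite_nb sep by auto
  \<comment> \<open>Of the seven further neighbours of this ear, the middle vertex accounts for at
    most \<open>i + 3\<close> and \<open>i + 4\<close>; five remain for \<open>i\<close>.\<close>
  have "nb i \<union> nb (i + 2) - {i, i + 1, i + 2} \<subseteq> (nb i - {i + 1, i + 2, i + 4}) \<union> {i + 3, i + 4}"
    using mid by auto
  then have "card (nb i \<union> nb (i + 2) - {i, i + 1, i + 2}) \<le> card ((nb i - {i + 1, i + 2, i + 4}) \<union> {i + 3, i + 4})"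
    using fin by (intro card_mono) auto
  also have "\<dots> \<le> card (nb i - {i + 1, i + 2, i + 4}) + card {i + 3, i + 4}" by (rule card_Un_le)
  also have "card {i + 3, i + 4} = 2" by simp
  finally show "5 \<le> card (nb i - {i + 1, i + 2, i + 4})"
    using ear_conditions(3)[of i] both sep by simp
  have "nb (i + 2) \<union> nb j - {i + 2, i + 3, i + 4} \<subseteq> (nb j - {i + 3, i + 2, i}) \<union> {i, i + 1}"
    using mid by auto
  then have "card (nb (i + 2) \<union> nb j - {i + 2, i + 3, i + 4}) \<le> card ((nb j - {i + 3, i + 2, i}) \<union> {i, i + 1})"
    using fin by (intro card_mono) auto
  also have "\<dots> \<le> card (nb j - {i + 3, i + 2, i}) + card {i, i + 1}" by (rule card_Un_le)
  also have "card {i, i + 1} = 2" by simp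
  finally show "5 \<le> card (nb j - {i + 3, i + 2, i})"
    using ear_conditions(3)[of "i + 2"] both sep j by (simp add: eval_nat_numeral)
qed

lemma no_fan: False
proof -
  have no3: "\<not> sep k (k + 3)" if "k + 3 < D" for k
  proof
    assume s: "sep k (k + 3)"
    have "k + 3 = k + 4"
      by (rule minimal_with_ears(1)[OF s that]) auto
    then show False by simp
  qed
  have four: "5 \<le> card (nb k - {k + 1, k + 2, k + 4}) \<and> 5 \<le> card (nb (k + 4) - {k + 3, k + 2, k})"
    if k: "k + 4 < D" and s: "sep k (k + 4)" for k
  proof -
    have "l' \<le> k' + 2" if "k \<le> k'" "k' < l'" "l' \<le> k + 4" "sep k' l'" "(k', l') \<noteq> (k, k + 4)" for k' l'
    proof (rule ccontr)
      assume "\<not> l' \<le> k' + 2"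
      then have "l' = k' + 3" using that by auto
      then show False using no3[of k'] that k by simp
    qed
    then show ?thesis using minimal_with_ears(2,3)[OF s k] by auto
  qed
  define P where "P n \<longleftrightarrow> (\<exists>i j. sep i j \<and> i + 5 \<le> j \<and> j < D \<and> j - i = n)" for n
  \<comment> \<open>No position lies outside this pair, so a shortest separating pair of length at
    least 5 exists.\<close>
  have "sep 0 (D - 1)" by (auto simp: sep_def)
  then have "P (D - 1)" using D unfolding P_def by (intro exI[of _ 0] exI[of _ "D - 1"]) auto
  then have "P (LEAST n. P n)" by (rule LeastI)
  then obtain i j where ij: "sep i j" "i + 5 \<le> j" "j < D" "j - i = (LEAST n. P n)"
    unfolding P_def by auto
  \<comment> \<open>By minimality, and since length 3 is impossible, proper subpairs have length 1,
    2 or 4.\<close>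
  have small: "l \<le> k + 4 \<and> l \<noteq> k + 3" if "i \<le> k" "k < l" "l \<le> j" "sep k l" "(k, l) \<noteq> (i, j)" for k l
  proof
    show "l \<noteq> k + 3" using no3[of k] that ij by auto
    show "l \<le> k + 4"
    proof (rule ccontr)
      assume "\<not> ?thesis"
      then have "P (l - k)" using that ij unfolding P_def by (intro exI[of _ k] exI[of _ l]) auto
      then have "j - i \<le> l - k" using ij(4) Least_le by metis
      then show False using that by auto
    qed
  qed
  have nb: "nb p \<subseteq> {p - 4, p - 2, p - 1, p + 1, p + 2, p + 4}" if p: "i < p" "p < j" for p
  proof
    fix l assume l: "l \<in> nb p"
    have pD: "p < D" using p ij by simp
    have il: "i \<le> l" "l \<le> j" using sep_nb[OF ij(1) p ij(3) l] by auto
    have "l \<noteq> p" using l nb_irrefl[OF pD] by blast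
    then consider "l < p" | "p < l" by linarith
    then show "l \<in> {p - 4, p - 2, p - 1, p + 1, p + 2, p + 4}"
    proof cases
      case 1
      then have "sep l p" using sep_edge pD nb_sym[OF pD l] by blast
      then have "p \<le> l + 4 \<and> p \<noteq> l + 3" using small[of l p] 1 il p by auto
      then have "p = l + 1 \<or> p = l + 2 \<or> p = l + 4" using 1 by linarith
      then show ?thesis by auto
    next
      case 2
      then have "sep p l" using sep_edge il l ij by auto
      then have "l \<le> p + 4 \<and> l \<noteq> p + 3" using small[of p l] 2 il p by auto
      then have "l = p + 1 \<or> l = p + 2 \<or> l = p + 4" using 2 by linarith
      then show ?thesis by auto
    qed
  qed
  \<comment> \<open>A proper subpair of length 4 has an end interior to \<open>(i, j)\<close>. It
    needs five neighbours elsewhere, but admissible edge lengths leave only three on its far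
    side.\<close>
  have "l \<le> k + 2" if kl: "i \<le> k" "k < l" "l \<le> j" "sep k l" "(k, l) \<noteq> (i, j)" for k l
  proof (rule ccontr)
    assume "\<not> l \<le> k + 2"
    then have l: "l = k + 4" using small[OF kl] by linarith
    note big = four[of k] 
    show False
    proof (cases "i < k")
      case True
      then have "nb k - {k + 1, k + 2, k + 4} \<subseteq> {k - 4, k - 2, k - 1}" using nb[of k] kl by auto
      then have "card (nb k - {k + 1, k + 2, k + 4}) \<le> card {k - 4, k - 2, k - 1}"
        by (intro card_mono) auto
      also have "\<dots> \<le> 3" by (simp add: card_insert_if)
      finally show False using big kl l ij by simp
    next
      case False
      then have "nb (k + 4) - {k + 3, k + 2, k} \<subseteq> {k + 5, k + 6, k + 8}" using nb[of "k + 4"] kl ij l by auto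
      then have "card (nb (k + 4) - {k + 3, k + 2, k}) \<le> card {k + 5, k + 6, k + 8}"
        by (intro card_mono) auto
      also have "\<dots> \<le> 3" by (simp add: card_insert_if)
      finally show False using big kl l ij by simp
    qed
  qed
  then have "j = i + 4" using minimal_with_ears(1)[OF ij(1,3)] ij by simp
  then show False using ij by simp
qed

end

section \<open>The degree bound\<close>

lemma finite_increasing_enumeration:
  fixes pos :: "'a \<Rightarrow> real"
  assumes "finite U" "inj_on pos U"
  obtains u :: "nat \<Rightarrow> 'a" where "bij_betw u {..<card U} U"
    and "\<And>i j. i < j \<Longrightarrow> j < card U \<Longrightarrow> pos (u i) < pos (u j)"
proof -
  define L where "L = sorted_list_of_set (pos ` U)"
  have len: "length L = card U" and setL: "set L = pos ` U" and distL: "distinct L"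
    using assms by (simp_all add: L_def card_image)
  have less: "L ! i < L ! j" if "i < j" "j < card U" for i j
    using that len sorted_wrt_nth_less[of "(<)" L i j] strict_sorted_list_of_set[of "pos ` U"]
    by (simp add: L_def)
  have nth: "bij_betw ((!) L) {..<card U} (pos ` U)"
    by (rule bij_betw_nth) (simp_all add: distL len setL)
  have inv: "bij_betw (inv_into U pos) (pos ` U) U"
    by (rule bij_betw_inv_into[OF inj_on_imp_bij_betw[OF assms(2)]])
  show thesis
  proof (rule that[of "inv_into U pos \<circ> (!) L"])
    show "bij_betw (inv_into U pos \<circ> (!) L) {..<card U} U"
      by (rule bij_betw_trans[OF nth inv])
    fix i j assume ij: "i < j" "j < card U"
    then have "L ! i \<in> pos ` U" "L ! j \<in> pos ` U"
      using nth_mem[of i L] nth_mem[of j L] unfolding len setL by simp_all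
    then show "pos ((inv_into U pos \<circ> (!) L) i) < pos ((inv_into U pos \<circ> (!) L) j)"
      using less[OF ij] by (simp add: f_inv_into_f)
  qed
qed

text \<open>A vertex of degree at least 18 would produce an instance of \<open>fan\<close>: the
  rotation order numbers its neighbours, and planarity and curvature supply the assumptions.\<close>

lemma degree_less_18:
  assumes graph: "simple_graph V E" and conn: "connected_graph V E" and planar: "planar_graph V E"
    and lfin: "locally_finite_graph V E" and min3: "\<And>v. v \<in> V \<Longrightarrow> 3 \<le> degree E v"
    and pos_curv: "positively_curved E" and x: "x \<in> V"
  shows "degree E x < 18"
proof (rule ccontr)
  assume "\<not> degree E x < 18"
  then have D18: "18 \<le> degree E x" by simp
  define U where "U = nbhd E x"
  define D where "D = card U"
  have irrefl: "v \<notin> nbhd E v" for v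
    using graph by (auto simp: simple_graph_def nbhd_def)
  have nbV: "nbhd E v \<subseteq> V" for v
    using graph by (auto simp: simple_graph_def nbhd_def)
  have fin: "finite (nbhd E v)" if "v \<in> V" for v
    using lfin that by (simp add: locally_finite_graph_def)
  have UV: "U \<subseteq> V" and finU: "finite U" and xU: "x \<notin> U"
    using nbV[of x] fin[OF x] irrefl by (simp_all add: U_def)
  \<comment> \<open>Only edges at neighbours of \<open>x\<close> occur in the connections
    considered, and local finiteness leaves finitely many of them.\<close>
  define F where "F = (\<Union>v\<in>U. (\<lambda>w. {v, w}) ` (nbhd E v - {x}))"
  have F: "finite F" "F \<subseteq> E" "\<And>e. e \<in> F \<Longrightarrow> x \<notin> e"
  proof -
    show "finite F" unfolding F_def using finU fin UV by blast
    show "F \<subseteq> E" by (auto simp: F_def nbhd_def)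
    show "x \<notin> e" if "e \<in> F" for e using that xU by (auto simp: F_def)
  qed
  have F_I: "{v, w} \<in> F" "{w, v} \<in> F" if "v \<in> U" "w \<in> nbhd E v" "w \<noteq> x" for v w
    using that by (auto simp: F_def insert_commute)
  obtain p \<gamma> where drawing: "plane_drawing V E p \<gamma>"
    using planar by (auto simp: planar_graph_def)
  obtain pos :: "'a \<Rightarrow> real" where inj_pos: "inj_on pos U"
    and no_cross: "\<And>A B a b c d. \<lbrakk>A \<inter> B = {}; x \<notin> A; x \<notin> B; linked F A a c; linked F B b d;
      {a, b, c, d} \<subseteq> U; pos a < pos b; pos b < pos c; pos c < pos d\<rbrakk> \<Longrightarrow> False"
    using planar_rotation[OF graph drawing x fin[OF x] F] unfolding U_def by blast
  obtain u where bij: "bij_betw u {..<D} U" and incr: "\<And>i j. i < j \<Longrightarrow> j < D \<Longrightarrow> pos (u i) < pos (u j)"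
    using finite_increasing_enumeration[OF finU inj_pos] unfolding D_def by blast
  have uU: "u k \<in> U" if "k < D" for k
    using bij that by (auto simp: bij_betw_def)
  have u_inj: "u k = u l \<longleftrightarrow> k = l" if "k < D" "l < D" for k l
    using bij that by (auto simp: bij_betw_def inj_on_def)
  have u_ex: "\<exists>k<D. v = u k" if "v \<in> U" for v
    using bij that by (force simp: bij_betw_def)
  define nb where "nb k = {l. l < D \<and> {u k, u l} \<in> E}" for k
  define out where "out k = nbhd E (u k) - insert x U" for k
  have nbD: "nb k \<subseteq> {..<D}" for k by (auto simp: nb_def)
  have fin_nb: "finite (nb k)" for k using nbD finite_subset by blast
  have fin_out: "finite (out k)" if "k < D" for k
    using fin UV uU[OF that] by (auto simp: out_def)
  have card_u: "card (u ` T) = card T" if "T \<subseteq> {..<D}" for T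
    using bij that by (meson bij_betw_def card_image inj_on_subset)
  have nbhd_u: "nbhd E (u k) = insert x (u ` nb k \<union> out k)" if k: "k < D" for k
  proof -
    have "x \<in> nbhd E (u k)" using uU[OF k] by (simp add: U_def nbhd_def insert_commute)
    moreover have "nbhd E (u k) \<inter> U = u ` nb k"
      using u_ex uU by (auto simp: nb_def nbhd_def)
    ultimately show ?thesis by (auto simp: out_def)
  qed
  have deg_u: "degree E (u k) = 1 + card (nb k) + card (out k)" if k: "k < D" for k
  proof -
    have "u ` nb k \<subseteq> U" using uU by (auto simp: nb_def)
    then have "x \<notin> u ` nb k \<union> out k" "u ` nb k \<inter> out k = {}"
      using xU by (auto simp: out_def)
    then show ?thesis
      unfolding degree_def nbhd_u[OF k] using fin_nb[of k] fin_out[OF k] card_u[OF nbD]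
      by (simp add: card_Un_disjoint)
  qed
  have link_nb: "linked F {u a, u c} (u a) (u c)" if "a < D" "c < D" "c \<in> nb a" for a c
  proof -
    have "{u a, u c} \<in> F"
      using that uU xU by (intro F_I) (auto simp: nb_def nbhd_def)
    then show ?thesis by (auto simp: linked_def)
  qed
  have link_out: "linked F {u a, w, u c} (u a) (u c)" if "a < D" "c < D" "w \<in> out a" "w \<in> out c" for a c w
  proof -
    have "{u a, w} \<in> F" "{w, u c} \<in> F"
      using that uU F_I by (auto simp: out_def)
    then show ?thesis
      unfolding linked_def by (auto intro: converse_rtranclp_into_rtranclp[of _ "u a" w] r_into_rtranclp)
  qed
  have cross: False
    if "a < b" "b < c" "c < d" "d < D" "linked F A (u a) (u c)" "linked F B (u b) (u d)"
      "A \<inter> B = {}" "x \<notin> A" "x \<notin> B" for A B a b c d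
    using no_cross[of A B "u a" "u c" "u b" "u d"] that uU incr by simp
  have uw: "u k \<noteq> w" "w \<noteq> u k" "w \<noteq> x" "x \<noteq> w" if "w \<in> out l" "k < D" for k l w
    using that uU by (auto simp: out_def)
  have ux: "u k \<noteq> x" "x \<noteq> u k" if "k < D" for k
    using uU[OF that] xU by auto
  interpret fan D nb out "\<lambda>w. {l. l < D \<and> w \<in> out l}"
  proof unfold_locales
    show "18 \<le> D" using D18 by (simp add: D_def U_def degree_def)
    show "l < D" if "k < D" "l \<in> nb k" for k l using that by (simp add: nb_def)
    show "k \<in> nb l" if "k < D" "l \<in> nb k" for k l using that by (simp add: nb_def insert_commute)
    show "k \<notin> nb k" if "k < D" for k using irrefl[of "u k"] by (simp add: nb_def nbhd_def)
    show "finite (out k)" if "k < D" for k using fin_out[OF that] .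
    show "2 \<le> card (nb k) + card (out k)" if "k < D" for k
      using min3[of "u k"] deg_u[OF that] uU[OF that] UV by auto
  next
    fix k T W C
    assume k: "k < D" and T: "T \<subseteq> nb k" and W: "W \<subseteq> out k" and C: "finite C"
      and CT: "(\<Union>l\<in>T. nb l) \<subseteq> C \<union> insert k (nb k)"
      and CW: "(\<Union>w\<in>W. {l. l < D \<and> w \<in> out l}) \<subseteq> C \<union> insert k (nb k)"
    have TU: "u ` T \<subseteq> U" and WU: "W \<inter> U = {}" using T W nbD uU by (auto simp: out_def nb_def)
    have kE: "{x, u k} \<in> E" using uU[OF k] by (simp add: U_def nbhd_def)
    \<comment> \<open>The test set consists of the neighbours of \<open>x\<close> numbered by
      \<open>T\<close> together with the outer vertices \<open>W\<close>.\<close>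
    have "degree E x * card (u ` T \<union> W)
      < degree E (u k) * (2 + card (nbhd E x \<inter> nbhd E (u k)) + card ((u ` T \<union> W) \<inter> nbhd E x) + card (u ` C))"
    proof (rule curvature_inequality[OF graph conn lfin pos_curv kE])
      show "u ` T \<union> W \<subseteq> nbhd E (u k) - {x}"
        using nbhd_u[OF k] T W TU xU by (auto simp: out_def)
      show "finite (u ` C)" using C by simp
      fix v s assume v: "v \<in> nbhd E x" "v \<noteq> u k" "v \<notin> nbhd E (u k)"
        and s: "s \<in> u ` T \<union> W" "{s, v} \<in> E"
      obtain l where l: "l < D" "v = u l" using u_ex v by (auto simp: U_def)
      then have "l \<noteq> k" "l \<notin> nb k" using v by (auto simp: nb_def nbhd_def)
      moreover have "l \<in> C \<union> insert k (nb k)"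
        using s(1)
      proof
        assume "s \<in> u ` T"
        then show ?thesis using CT s(2) l by (auto simp: nb_def)
      next
        assume sW: "s \<in> W"
        then have "s \<in> out l" using W s(2) l by (auto simp: out_def nbhd_def insert_commute)
        then show ?thesis using CW sW l by blast
      qed
      ultimately show "v \<in> u ` C" using l by blast
    qed
    moreover have "card (u ` T \<union> W) = card T + card W"
    proof -
      have "finite T" "finite W" using T W fin_nb fin_out[OF k] finite_subset by blast+
      then have "card (u ` T \<union> W) = card (u ` T) + card W"
        using TU WU by (intro card_Un_disjoint) auto
      moreover have "card (u ` T) = card T" by (rule card_u) (use T nbD in blast)
      ultimately show ?thesis by simp
    qed
    moreover have "nbhd E x \<inter> nbhd E (u k) = u ` nb k"
      using u_ex uU by (auto simp: nb_def nbhd_def U_def)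
    moreover have "(u ` T \<union> W) \<inter> nbhd E x = u ` T"
      using TU WU by (auto simp: U_def)
    moreover have "card (u ` nb k) = card (nb k)" "card (u ` T) = card T"
      using T nbD by (blast intro: card_u)+
    ultimately have "degree E x * (card T + card W)
        < (1 + card (nb k) + card (out k)) * (2 + card (nb k) + card T + card (u ` C))"
      using deg_u[OF k] by simp
    also have "\<dots> \<le> (1 + card (nb k) + card (out k)) * (2 + card (nb k) + card T + card C)"
      using card_image_le[OF C, of u] by (intro mult_left_mono) auto
    finally show "18 * (card T + card W) < (1 + card (nb k) + card (out k)) * (2 + card (nb k) + card T + card C)"
      using mult_right_mono[OF D18, of "card T + card W"] by linarith
  next
    fix a b c d :: nat and w w' assume less: "a < b" "b < c" "c < d" "d < D"
    have lt: "a < D" "b < D" "c < D" using less by auto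
    have ne: "u a \<noteq> u b" "u a \<noteq> u d" "u c \<noteq> u b" "u c \<noteq> u d" using u_inj lt less by auto
    note u_ne = ne ne[symmetric] ux[OF lt(1)] ux[OF lt(2)] ux[OF lt(3)] ux[OF less(4)]
    show False if "c \<in> nb a" "d \<in> nb b"
      by (rule cross[OF less link_nb link_nb]) (use that less u_ne in auto)
    show False if w: "c \<in> nb a" "w \<in> out b" "w \<in> out d"
      by (rule cross[OF less link_nb link_out[of b d w]]) (use w lt less u_ne uw[OF w(2)] in auto)
    show False if w: "w \<in> out a" "w \<in> out c" "d \<in> nb b"
      by (rule cross[OF less link_out[of a c w] link_nb]) (use w lt less u_ne uw[OF w(1)] in auto)
    show False if w: "w \<in> out a" "w \<in> out c" "w' \<in> out b" "w' \<in> out d" "w \<noteq> w'"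
      by (rule cross[OF less link_out[of a c w] link_out[of b d w']])
         (use w lt less u_ne uw[OF w(1)] uw[OF w(3)] in auto)
  qed
  show False by (rule no_fan)
qed

theorem theorem1p6:
  fixes V :: "'a set" and E :: "'a set set"
  assumes "simple_graph V E"
    and "connected_graph V E"
    and "planar_graph V E"
    and "locally_finite_graph V E"
    and "min_degree V E \<ge> 3"
    and "positively_curved E"
  shows "max_degree V E \<le> 17"
  unfolding max_degree_def
proof (rule SUP_least)
  have min3: "3 \<le> degree E v" if "v \<in> V" for v
  proof -
    have "(3 :: enat) \<le> enat (degree E v)"
      using assms(5) that unfolding min_degree_def by (meson INF_lower order_trans)
    then show ?thesis by (simp add: numeral_eq_enat)
  qed
  fix x assume "x \<in> V"
  then have "degree E x \<le> 17"
    using degree_less_18[OF assms(1-4) min3 assms(6)] by fastforce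
  then show "enat (degree E x) \<le> 17"
    by (simp add: numeral_eq_enat)
qed

end
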